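(* Let $k>0$ and $a>b>0$. Let $D$ be the region enclosed by the ellipse $x(t)=(x_1(t),x_2(t))=(a\cos t,b\sin t)$, $t\in[-\pi,\pi]$, having a constant refractive index $0<q\neq1$. Let $$\mathcal T_0=\left\{r+is:\ |r|\le\arccos\sqrt{1-\tfrac{b^2}{a^2}},\quad 0\le s\le\ln\left(\frac{1-|\sin r|}{\cos r}\sqrt{\frac{a+b}{a-b}}\right)\right\}\subset\mathbb C .$$ Let $u^{\mathrm{in}}$ be an incident wave with wave number $k$ that extends to an analytic function of two complex variables in an open set of $\mathbb C^2$ containing $\{(x_1(t),x_2(t)):t\in\mathcal T_0\}$. Assume that $$u^{\mathrm{in}}\left(\frac{a^2}{\sqrt{a^2-b^2}},\frac{ib^2}{\sqrt{a^2-b^2}}\right)\neq0 .$$ Then $u^{\mathrm{in}}$ is scattered by $D$.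
   Context: An incident wave with wave number $k>0$ is a non-trivial solution $u^{\mathrm{in}}$ of $\Delta u^{\mathrm{in}}+k^2u^{\mathrm{in}}=0$ in $\mathbb R^2$. For a bounded simply connected planar domain $D$ with constant refractive index $q$ (the index is $1$ outside $D$), $u^{\mathrm{in}}$ is called nonscattering for $D$ if there is $u\in H^2_{\mathrm{loc}}(\mathbb R^2)$ with $u=0$ in $\mathbb R^2\setminus D$ and $\Delta u+k^2qu=k^2(1-q)u^{\mathrm{in}}\chi_D$ in $\mathbb R^2$, where $\chi_D$ is the indicator function of $D$ (here $u$ is the total field minus $u^{\mathrm{in}}$). Otherwise $u^{\mathrm{in}}$ is said to be scattered by $D$. For complex $t$, $x_1(t)=a\cos t$ and $x_2(t)=b\sin t$ denote the entire extensions, and $u^{\mathrm{in}}$ at complex points denotes its analytic extension. *)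

theory Defs
  imports "HOL-Complex_Analysis.Complex_Analysis"
begin

definition partial_deriv ::
    "'a::euclidean_space \<Rightarrow> ('a \<Rightarrow> 'b::real_normed_vector) \<Rightarrow> 'a \<Rightarrow> 'b" where
  "partial_deriv e f x = frechet_derivative f (at x) e"

primrec Ck :: "nat \<Rightarrow> ('a::euclidean_space \<Rightarrow> 'b::real_normed_vector) \<Rightarrow> bool" where
  "Ck 0 f \<longleftrightarrow> continuous_on UNIV f"
| "Ck (Suc n) f \<longleftrightarrow> (\<forall>x. f differentiable (at x)) \<and> (\<forall>e\<in>Basis. Ck n (partial_deriv e f))"

definition laplacian :: "('a::euclidean_space \<Rightarrow> 'b::real_normed_vector) \<Rightarrow> 'a \<Rightarrow> 'b" where
  "laplacian f x = (\<Sum>e\<in>Basis. partial_deriv e (partial_deriv e f) x)"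

text \<open>By elliptic regularity every distributional solution is a classical one, so it is no
  restriction to ask for a twice continuously differentiable representative.\<close>

definition incident_wave :: "real \<Rightarrow> (real \<times> real \<Rightarrow> complex) \<Rightarrow> bool" where
  "incident_wave k u \<longleftrightarrow>
     Ck 2 u \<and> (\<forall>x. laplacian u x + of_real (k\<^sup>2) * u x = 0) \<and> (\<exists>x. u x \<noteq> 0)"

definition test_function :: "('a::euclidean_space \<Rightarrow> real) \<Rightarrow> bool" where
  "test_function \<phi> \<longleftrightarrow> (\<forall>n. Ck n \<phi>) \<and> compact (closure {x. \<phi> x \<noteq> 0})"

definition L1_loc :: "('a::euclidean_space \<Rightarrow> complex) \<Rightarrow> bool" where
  "L1_loc u \<longleftrightarrow> (\<forall>K. compact K \<longrightarrow> set_integrable lebesgue K u)"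

definition L2_loc :: "('a::euclidean_space \<Rightarrow> complex) \<Rightarrow> bool" where
  "L2_loc u \<longleftrightarrow> u \<in> borel_measurable lebesgue \<and>
     (\<forall>K. compact K \<longrightarrow> set_integrable lebesgue K (\<lambda>x. (norm (u x))\<^sup>2))"

definition weak_partial ::
    "'a::euclidean_space \<Rightarrow> ('a \<Rightarrow> complex) \<Rightarrow> ('a \<Rightarrow> complex) \<Rightarrow> bool" where
  "weak_partial e u v \<longleftrightarrow> L1_loc u \<and> L1_loc v \<and>
     (\<forall>\<phi>. test_function \<phi> \<longrightarrow>
        (LINT x|lebesgue. of_real (partial_deriv e \<phi> x) * u x)
          = - (LINT x|lebesgue. of_real (\<phi> x) * v x))"

primrec H_loc :: "nat \<Rightarrow> ('a::euclidean_space \<Rightarrow> complex) \<Rightarrow> bool" where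
  "H_loc 0 u \<longleftrightarrow> L2_loc u"
| "H_loc (Suc m) u \<longleftrightarrow> L2_loc u \<and> (\<forall>e\<in>Basis. \<exists>v. weak_partial e u v \<and> H_loc m v)"

text \<open>Functions stand for their classes modulo null sets; \<open>L\<close> is a representative of the
  weak Laplacian of \<open>u\<close>.\<close>

definition weak_laplacian ::
    "('a::euclidean_space \<Rightarrow> complex) \<Rightarrow> ('a \<Rightarrow> complex) \<Rightarrow> bool" where
  "weak_laplacian u L \<longleftrightarrow>
     (\<exists>v w. (\<forall>e\<in>Basis. weak_partial e u (v e) \<and> weak_partial e (v e) (w e)) \<and>
            L = (\<lambda>x. \<Sum>e\<in>Basis. w e x))"

definition nonscattering ::
    "real \<Rightarrow> real \<Rightarrow> (real \<times> real) set \<Rightarrow> (real \<times> real \<Rightarrow> complex) \<Rightarrow> bool" where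
  "nonscattering k q D uin \<longleftrightarrow>
     (\<exists>u L. H_loc 2 u \<and> weak_laplacian u L \<and>
        (AE x in lebesgue. x \<notin> D \<longrightarrow> u x = 0) \<and>
        (AE x in lebesgue. L x + of_real (k\<^sup>2 * q) * u x
                             = of_real (k\<^sup>2 * (1 - q)) * uin x * indicator D x))"

definition scattered ::
    "real \<Rightarrow> real \<Rightarrow> (real \<times> real) set \<Rightarrow> (real \<times> real \<Rightarrow> complex) \<Rightarrow> bool" where
  "scattered k q D uin \<longleftrightarrow> \<not> nonscattering k q D uin"

definition ellipse :: "real \<Rightarrow> real \<Rightarrow> real \<Rightarrow> real \<times> real" where
  "ellipse a b t = (a * cos t, b * sin t)"

definition ellipse_region :: "real \<Rightarrow> real \<Rightarrow> (real \<times> real) set" where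
  "ellipse_region a b = inside (ellipse a b ` {-pi..pi})"

definition cellipse :: "real \<Rightarrow> real \<Rightarrow> complex \<Rightarrow> complex \<times> complex" where
  "cellipse a b t = (of_real a * cos t, of_real b * sin t)"

definition T0 :: "real \<Rightarrow> real \<Rightarrow> complex set" where
  "T0 a b = {Complex r s | r s.
     \<bar>r\<bar> \<le> arccos (sqrt (1 - b\<^sup>2 / a\<^sup>2)) \<and> 0 \<le> s \<and>
     s \<le> ln ((1 - \<bar>sin r\<bar>) / cos r * sqrt ((a + b) / (a - b)))}"

definition analytic2_on :: "(complex \<times> complex \<Rightarrow> complex) \<Rightarrow> (complex \<times> complex) set \<Rightarrow> bool" where
  "analytic2_on F U \<longleftrightarrow>
     (\<forall>(z0, w0)\<in>U. \<exists>c. \<exists>\<rho>>0. \<forall>z w. norm (z - z0) < \<rho> \<and> norm (w - w0) < \<rho> \<longrightarrow>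
        ((\<lambda>(m, n). c m n * (z - z0) ^ m * (w - w0) ^ n) has_sum F (z, w)) (UNIV :: (nat \<times> nat) set))"

text \<open>The extension has to agree with \<open>u\<close> at every real point of \<open>U\<close>; \<open>U\<close> need not contain
  all of the real plane.\<close>

definition analytic_extension ::
    "(real \<times> real \<Rightarrow> complex) \<Rightarrow> (complex \<times> complex) set \<Rightarrow> (complex \<times> complex \<Rightarrow> complex) \<Rightarrow> bool" where
  "analytic_extension u U F \<longleftrightarrow> open U \<and> analytic2_on F U \<and>
     (\<forall>x y. (of_real x, of_real y) \<in> U \<longrightarrow> F (of_real x, of_real y) = u (x, y))"

end

theory Submission
  imports Defs
begin

text \<open>
  Write \<open>c = sqrt (a\<^sup>2 - b\<^sup>2)\<close>, \<open>Z = x\<^sub>1 + \<i> x\<^sub>2\<close> and \<open>W = x\<^sub>1 - \<i> x\<^sub>2\<close> along the ellipse, so that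
  \<open>Z(t) = c cos (t - \<i> h)\<close> with \<open>cosh h = a / c\<close>. If \<open>u\<close> is nonscattering, it is orthogonal on the ellipse to every
  solution of the Helmholtz equation with wave number \<open>k sqrt q\<close>, in particular to \<open>exp (\<lambda> Z + \<mu> W)\<close> with
  \<open>4 \<lambda> \<mu> = - k\<^sup>2 q\<close>. Green's formula turns this into
  \<open>\<integral> exp (\<lambda> Z + \<mu> W) (\<mu> W' u + Z' \<partial>\<^sub>z u) dt = 0\<close> over \<open>[-\<pi>, \<pi>]\<close>.
  As \<open>\<lambda> \<longlongrightarrow> \<infinity>\<close>, the part of the contour where the real axis lies below \<open>T0\<close> is pushed up, inside a neighbourhood
  of \<open>T0\<close>, to a contour through the critical point \<open>\<i> h\<close> of \<open>Z\<close> on which \<open>Re Z\<close> is maximal exactly there.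
  After one integration by parts the amplitude at \<open>\<i> h\<close> is \<open>(\<partial>\<^sub>z u)' + (k\<^sup>2 q / 4) u W'\<close>, and since
  \<open>Z' = 0\<close> there and \<open>4 \<partial>\<^sub>z \<partial>\<^sub>w u = - k\<^sup>2 u\<close>, this equals \<open>(q - 1) (k\<^sup>2 / 4) u W'\<close>. It has to vanish,
  but \<open>q \<noteq> 1\<close>, \<open>W' \<noteq> 0\<close> and \<open>u \<noteq> 0\<close> at this point.
\<close>

section \<open>Smooth test functions\<close>

text \<open>The shape of \<open>T0\<close> comes from a level set. For \<open>t = r + \<i> s\<close>
  one has Re Z = c cos r cosh (h - s), which equals c, the value at the saddle
  \<open>\<i> h\<close>, exactly on the curved sides of \<open>T0\<close>. A contour that climbs at
  horizontal distance \<delta> outside these sides satisfies Re Z \<le> c cos \<delta>, and so does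
  the part of the real axis beyond their feet, which stays where it is. Hence an extension of
  \<open>u\<close> to a neighbourhood of \<open>T0\<close> suffices. The leading amplitude
  \<open>Z' \<partial>\<^sub>z u\<close> vanishes at the saddle, so the information sits one order
  lower. Multiplying by \<lambda> turns \<open>\<lambda> Z' exp (\<lambda> Z)\<close> into a
  derivative, and since \<lambda> \<mu> is constant, the term with \<open>u\<close> then has the
  same order as the integrated one. Instead of a steepest descent expansion the contour crosses the
  saddle horizontally. There Z = c cos \<tau> is real and the kernel positive, so the crossing
  contributes at least a multiple of exp (\<lambda> c cos (\<delta>/2)). Everything else is at most
  of order (1 + \<lambda>) exp (\<lambda> c cos \<delta>), and large \<lambda> gives the
  contradiction.\<close>

lemma partial_deriv_eqI:
  assumes "(f has_derivative f') (at x)"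
  shows "partial_deriv e f x = f' e"
  using frechet_derivative_at[OF assms] by (simp add: partial_deriv_def)

text \<open>\<open>frechet_derivative\<close> is a choice among all derivatives. Both functions have
  the same ones at \<open>x\<close>, so the choices coincide even where neither function is
  differentiable.\<close>

lemma partial_deriv_cong_open:
  assumes "open S" "x \<in> S" "\<And>y. y \<in> S \<Longrightarrow> f y = g y"
  shows "partial_deriv e f x = partial_deriv e g x"
proof -
  have "(f has_derivative D) (at x) \<longleftrightarrow> (g has_derivative D) (at x)" for D
    using has_derivative_transform_within_open[OF _ assms(1,2), of f D UNIV g]
      has_derivative_transform_within_open[OF _ assms(1,2), of g D UNIV f] assms(3) by auto
  then show ?thesis by (simp add: partial_deriv_def frechet_derivative_def)
qed

lemma Ck_SucI:
  assumes "\<And>x. (f has_derivative f' x) (at x)" "\<And>e. e \<in> Basis \<Longrightarrow> Ck n (\<lambda>x. f' x e)"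
  shows "Ck (Suc n) f"
proof -
  have "partial_deriv e f = (\<lambda>x. f' x e)" for e
    using partial_deriv_eqI[OF assms(1)] by auto
  then show ?thesis using assms by (auto simp: differentiable_def)
qed

lemma Ck_Suc_has_derivative:
  assumes "Ck (Suc n) f"
  shows "(f has_derivative (\<lambda>e. partial_deriv e f x)) (at x)"
  using assms frechet_derivative_works[of f "at x"] by (simp add: partial_deriv_def)

lemma Ck_continuous: "Ck n f \<Longrightarrow> continuous_on UNIV f"
  by (cases n)
    (auto intro!: differentiable_imp_continuous_on simp: differentiable_on_def
      intro: differentiable_at_withinI)

lemma Ck_SucD: "Ck (Suc n) f \<Longrightarrow> Ck n f"
proof (induction n arbitrary: f)
  case 0
  then show ?case using Ck_continuous[of "Suc 0" f] by (simp only: Ck.simps(1))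
next
  case (Suc n)
  then show ?case by (metis Ck.simps(2))
qed

lemma Ck_const: "Ck n (\<lambda>x. c)"
proof (induction n arbitrary: c)
  case (Suc n)
  then show ?case by (intro Ck_SucI[where f' = "\<lambda>x e. 0"]) auto
qed simp

lemma Ck_bounded_linear:
  assumes "bounded_linear f"
  shows "Ck n f"
proof (cases n)
  case 0
  then show ?thesis using bounded_linear.continuous_on[OF assms continuous_on_id] by simp
next
  case (Suc m)
  show ?thesis
    unfolding Suc using bounded_linear_imp_has_derivative[OF assms] Ck_const by (rule Ck_SucI)
qed

lemma Ck_add: "Ck n f \<Longrightarrow> Ck n g \<Longrightarrow> Ck n (\<lambda>x. f x + g x)"
proof (induction n arbitrary: f g)
  case (Suc n)
  show ?case
    by (rule Ck_SucI[where f' = "\<lambda>x e. partial_deriv e f x + partial_deriv e g x"])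
      (use Suc in \<open>auto intro!: has_derivative_add Ck_Suc_has_derivative\<close>)
qed (auto intro: continuous_on_add)

lemma Ck_mult:
  fixes f g :: "'a::euclidean_space \<Rightarrow> 'b::real_normed_algebra"
  shows "Ck n f \<Longrightarrow> Ck n g \<Longrightarrow> Ck n (\<lambda>x. f x * g x)"
proof (induction n arbitrary: f g)
  case (Suc n)
  show ?case
  proof (rule Ck_SucI[where f' = "\<lambda>x e. f x * partial_deriv e g x + partial_deriv e f x * g x"])
    show "((\<lambda>x. f x * g x) has_derivative (\<lambda>e. f x * partial_deriv e g x + partial_deriv e f x * g x)) (at x)" for x
      using Suc.prems by (intro has_derivative_mult Ck_Suc_has_derivative)
    show "Ck n (\<lambda>x. f x * partial_deriv e g x + partial_deriv e f x * g x)" if "e \<in> Basis" for e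
      using Suc that Ck_SucD[OF Suc.prems(1)] Ck_SucD[OF Suc.prems(2)] by (auto intro!: Ck_add)
  qed
qed (auto intro: continuous_on_mult)

lemma Ck_inverse:
  fixes f :: "'a::euclidean_space \<Rightarrow> 'b::real_normed_field"
  assumes "\<And>x. f x \<noteq> 0"
  shows "Ck n f \<Longrightarrow> Ck n (\<lambda>x. inverse (f x))"
proof (induction n)
  case 0
  then show ?case using assms by (auto intro: continuous_on_inverse)
next
  case (Suc n)
  have inv: "Ck n (\<lambda>x. inverse (f x))" using Suc Ck_SucD by blast
  show ?case
  proof (rule Ck_SucI[where f' = "\<lambda>x e. - (inverse (f x) * partial_deriv e f x * inverse (f x))"])
    show "((\<lambda>x. inverse (f x)) has_derivative (\<lambda>e. - (inverse (f x) * partial_deriv e f x * inverse (f x)))) (at x)" for x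
      using Suc.prems assms by (intro Deriv.has_derivative_inverse Ck_Suc_has_derivative)
    show "Ck n (\<lambda>x. - (inverse (f x) * partial_deriv e f x * inverse (f x)))" if "e \<in> Basis" for e
    proof -
      have "Ck n (\<lambda>x. (-1) * (inverse (f x) * partial_deriv e f x * inverse (f x)))"
        using Suc.prems that inv by (intro Ck_mult Ck_const) auto
      then show ?thesis by simp
    qed
  qed
qed

text \<open>\<open>F\<close> is a tower in which each function is the derivative of its predecessor.
  Differentiating \<open>F i \<circ> g\<close> leads to \<open>F (Suc i) \<circ> g\<close>, so the
  induction on \<open>n\<close> runs with \<open>i\<close> arbitrary.\<close>

lemma Ck_comp_real:
  fixes g :: "'a::euclidean_space \<Rightarrow> real" and F :: "nat \<Rightarrow> real \<Rightarrow> real"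
  assumes F: "\<And>i x. (F i has_real_derivative F (Suc i) x) (at x)" and g: "\<And>n. Ck n g"
  shows "Ck n (\<lambda>x. F i (g x))"
proof (induction n arbitrary: i)
  case 0
  have "continuous_on UNIV (F i)"
    using F by (intro continuous_at_imp_continuous_on) (metis DERIV_isCont)
  then have "continuous_on UNIV (\<lambda>x. F i (g x))"
    using g[of 0] by (intro continuous_on_compose2[of UNIV "F i" UNIV g]) auto
  then show ?case by simp
next
  case (Suc n)
  show ?case
  proof (rule Ck_SucI[where f' = "\<lambda>x e. partial_deriv e g x * F (Suc i) (g x)"])
    show "((\<lambda>x. F i (g x)) has_derivative (\<lambda>e. partial_deriv e g x * F (Suc i) (g x))) (at x)" for x
      using DERIV_compose_FDERIV[OF F Ck_Suc_has_derivative[OF g]] .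
    show "Ck n (\<lambda>x. partial_deriv e g x * F (Suc i) (g x))" if "e \<in> Basis" for e
      using Suc g[of "Suc n"] that by (intro Ck_mult) auto
  qed
qed

lemma Ck_exp: "(\<And>n. Ck n g) \<Longrightarrow> Ck n (\<lambda>x. exp (g x :: real))"
  by (rule Ck_comp_real[where F = "\<lambda>_. exp"]) (rule DERIV_exp)

text \<open>Each derivative of the cosine is a phase shift by \<open>pi / 2\<close>, which provides
  the tower. The free phase \<open>d\<close> covers the sine as well, with
  \<open>d = - pi / 2\<close>.\<close>

lemma Ck_cos_add: "(\<And>n. Ck n g) \<Longrightarrow> Ck n (\<lambda>x. cos (g x + d :: real))"
proof -
  assume g: "\<And>n. Ck n g"
  have "((\<lambda>t. cos (t + d + real i * (pi / 2))) has_real_derivative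
      cos (x + d + real (Suc i) * (pi / 2))) (at x)" for i :: nat and x
  proof -
    have "cos (x + d + real (Suc i) * (pi / 2)) = - sin (x + d + real i * (pi / 2))"
    proof -
      have "x + d + real (Suc i) * (pi / 2) = (x + d + real i * (pi / 2)) + pi / 2"
        by (simp add: algebra_simps add_divide_distrib)
      then show ?thesis by (simp only: cos_add[of "_ + _" "pi / 2"] cos_pi_half sin_pi_half mult_zero_right mult_1_right diff_0)
    qed
    then show ?thesis by (auto intro!: derivative_eq_intros)
  qed
  from Ck_comp_real[where F = "\<lambda>i t. cos (t + d + real i * (pi / 2))" and i = 0, OF this g]
  show ?thesis by simp
qed

section \<open>Flat functions and smooth cutoffs\<close>

definition flat_exp :: "real poly \<Rightarrow> real \<Rightarrow> real" where
  "flat_exp p x = (if x > 0 then poly p (1 / x) * exp (- (1 / x)) else 0)"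

lemma poly_mult_exp_uminus_tendsto_0: "((\<lambda>y. poly p y * exp (- y)) \<longlongrightarrow> (0::real)) at_top"
proof -
  have "((\<lambda>y. \<Sum>i\<le>degree p. coeff p i * (y ^ i / exp y)) \<longlongrightarrow> (\<Sum>i\<le>degree p. coeff p i * 0)) at_top"
    by (intro tendsto_sum tendsto_mult tendsto_const tendsto_power_div_exp_0)
  then show ?thesis by (simp add: poly_altdef exp_minus sum_distrib_left divide_inverse mult_ac)
qed

text \<open>With y = 1 / x the chain rule sends p(y) exp (-y) to y^2 (p(y) - p'(y)) exp (-y). The
  family is thus closed under differentiation, and iterating this operation on polynomials gives the
  tower for \<open>Ck_comp_real\<close>.\<close>

lemma flat_exp_has_derivative:
  "(flat_exp p has_real_derivative flat_exp (monom 1 2 * (p - pderiv p)) x) (at x)"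
proof -
  consider "x > 0" | "x < 0" | "x = 0" by linarith
  then show ?thesis
  proof cases
    case 1
    have d: "((\<lambda>x. poly p (1 / x) * exp (- (1 / x))) has_real_derivative
        poly (monom 1 2 * (p - pderiv p)) (1 / x) * exp (- (1 / x))) (at x)"
      using 1 by (auto intro!: derivative_eq_intros simp: poly_monom field_simps power2_eq_square)
    have ev: "\<forall>\<^sub>F y in nhds x. poly p (1 / y) * exp (- (1 / y)) = flat_exp p y"
      using eventually_nhds_in_open[of "{0<..}" x] 1 by (auto elim!: eventually_mono simp: flat_exp_def)
    show ?thesis using DERIV_cong_ev[OF refl ev refl, THEN iffD1, OF d] 1 by (simp add: flat_exp_def[of _ x])
  next
    case 2
    have ev: "\<forall>\<^sub>F y in nhds x. 0 = flat_exp p y"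
      using eventually_nhds_in_open[of "{..<0}" x] 2 by (auto elim!: eventually_mono simp: flat_exp_def)
    show ?thesis
      using DERIV_cong_ev[OF refl ev refl, THEN iffD1, OF DERIV_const] 2 by (simp add: flat_exp_def[of _ x])
  next
    case 3
    \<comment> \<open>With y = 1 / h the right difference quotient at 0 is y p(y) exp (-y);
      \<open>pCons 0 p\<close> supplies the additional factor y.\<close>
    have "((\<lambda>h. poly (pCons 0 p) (inverse h) * exp (- inverse h)) \<longlongrightarrow> 0) (at_right (0::real))"
      using filterlim_compose[OF poly_mult_exp_uminus_tendsto_0 filterlim_inverse_at_top_right] .
    moreover have "\<forall>\<^sub>F h in at_right (0::real).
        poly (pCons 0 p) (inverse h) * exp (- inverse h) = (flat_exp p (0 + h) - flat_exp p 0) / h"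
      using eventually_at_right_less[of "0::real"]
      by eventually_elim (simp add: flat_exp_def divide_inverse)
    ultimately have R: "((\<lambda>h. (flat_exp p (0 + h) - flat_exp p 0) / h) \<longlongrightarrow> 0) (at_right 0)"
      by (rule Lim_transform_eventually)
    have "\<forall>\<^sub>F h in at_left (0::real). 0 = (flat_exp p (0 + h) - flat_exp p 0) / h"
      by (auto simp: eventually_at_filter flat_exp_def)
    then have L: "((\<lambda>h. (flat_exp p (0 + h) - flat_exp p 0) / h) \<longlongrightarrow> 0) (at_left 0)"
      by (rule Lim_transform_eventually[OF tendsto_const])
    have "((\<lambda>h. (flat_exp p (0 + h) - flat_exp p 0) / h) \<longlongrightarrow> 0) (at 0)"
      using filterlim_split_at[OF L R] .
    then show ?thesis using 3 by (simp add: DERIV_def flat_exp_def)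
  qed
qed

lemma Ck_flat_exp:
  assumes "\<And>n. Ck n g"
  shows "Ck n (\<lambda>x. flat_exp p (g x))"
proof -
  define P where "P i = ((\<lambda>p. monom 1 2 * (p - pderiv p)) ^^ i) p" for i
  have "(flat_exp (P i) has_real_derivative flat_exp (P (Suc i)) x) (at x)" for i x
    using flat_exp_has_derivative by (simp add: P_def)
  from Ck_comp_real[where F = "\<lambda>i. flat_exp (P i)" and i = 0, OF this assms]
  show ?thesis by (simp add: P_def)
qed

text \<open>The standard quotient g(s) / (g(s) + g(1 - s)) for the flat function g and s = r^2 + 1 -
  |x|^2. On the ball s \<ge> 1, hence g(1 - s) = 0 and the quotient is 1; for |x|^2 \<ge> r^2 + 1
  the numerator is 0. The denominator is positive because s and 1 - s are never both \<le>
  0.\<close>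

lemma cutoff_exists:
  obtains \<eta> :: "'a::euclidean_space \<Rightarrow> real"
  where "\<And>n. Ck n \<eta>" "\<And>x. norm x \<le> r \<Longrightarrow> \<eta> x = 1" "bounded {x. \<eta> x \<noteq> 0}"
proof -
  \<comment> \<open>The squared norm is spelled out in coordinates and subtraction as a product with
    -1, so that smoothness follows from sums, products and linear maps alone.\<close>
  define s :: "'a \<Rightarrow> real" where "s x = (r\<^sup>2 + 1) + (-1) * (\<Sum>b\<in>Basis. (x \<bullet> b) * (x \<bullet> b))" for x
  have s_eq: "s x = r\<^sup>2 + 1 - (norm x)\<^sup>2" for x
    by (simp add: s_def euclidean_inner[of x x, symmetric] power2_norm_eq_inner)
  have "Ck n (\<lambda>x::'a. \<Sum>b\<in>B. (x \<bullet> b) * (x \<bullet> b))" if "finite B" for B n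
    using that
  proof induction
    case (insert b B)
    then show ?case
      unfolding sum.insert[OF insert.hyps]
      by (intro Ck_add Ck_mult Ck_bounded_linear[OF bounded_linear_inner_left] insert.IH)
  qed (simp add: Ck_const)
  then have s: "Ck n s" for n
    unfolding s_def by (intro Ck_add Ck_mult Ck_const) auto
  have s': "Ck n (\<lambda>x. 1 + (-1) * s x)" for n
    by (intro Ck_add Ck_mult Ck_const s)
  define g where "g = flat_exp 1"
  have g: "g t = (if t > 0 then exp (- (1 / t)) else 0)" for t
    by (simp add: g_def flat_exp_def)
  define \<eta> where "\<eta> x = g (s x) * inverse (g (s x) + g (1 + (-1) * s x))" for x
  have "g (s x) + g (1 + (-1) * s x) > 0" for x
    by (auto simp: g add_pos_pos)
  then have "Ck n \<eta>" for n
    unfolding \<eta>_def g_def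
    by (intro Ck_mult Ck_inverse Ck_add Ck_flat_exp s s') (simp add: less_imp_neq[symmetric])
  moreover have "\<eta> x = 1" if "norm x \<le> r" for x
    using power_mono[OF that, of 2] by (simp add: \<eta>_def s_eq g)
  moreover have "bounded {x. \<eta> x \<noteq> 0}"
  proof (rule boundedI)
    fix x assume "x \<in> {x. \<eta> x \<noteq> 0}"
    then have "s x > 0" by (auto simp: \<eta>_def g split: if_splits)
    then show "norm x \<le> sqrt (r\<^sup>2 + 1)" by (simp add: s_eq real_le_rsqrt)
  qed
  ultimately show ?thesis by (rule that)
qed

section \<open>The weak formulation tested with solutions of the interior equation\<close>

lemma test_function_partial_deriv:
  fixes \<phi> :: "'a::euclidean_space \<Rightarrow> real"
  assumes "test_function \<phi>" "e \<in> Basis"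
  shows "test_function (partial_deriv e \<phi>)"
proof -
  have Ck: "Ck n (partial_deriv e \<phi>)" for n
    using assms unfolding test_function_def by (metis Ck.simps(2))
  have "partial_deriv e \<phi> x = 0" if "x \<notin> closure {x. \<phi> x \<noteq> 0}" for x
  proof -
    have "partial_deriv e \<phi> x = partial_deriv e (\<lambda>_. 0) x"
      using that closure_subset[of "{x. \<phi> x \<noteq> 0}"]
      by (intro partial_deriv_cong_open[of "- closure {x. \<phi> x \<noteq> 0}"]) auto
    then show ?thesis by (simp add: partial_deriv_def)
  qed
  then have "closure {x. partial_deriv e \<phi> x \<noteq> 0} \<subseteq> closure {x. \<phi> x \<noteq> 0}"
    by (intro closure_minimal) auto
  then show ?thesis
    using Ck assms(1) unfolding test_function_def
    by (metis closed_Int_compact closed_closure inf.absorb_iff1)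
qed

lemma test_function_mult_integrable:
  fixes \<phi> :: "'a::euclidean_space \<Rightarrow> real"
  assumes \<phi>: "test_function \<phi>" and w: "L1_loc w"
  shows "integrable lebesgue (\<lambda>x. of_real (\<phi> x) * w x)"
proof -
  let ?K = "closure {x. \<phi> x \<noteq> 0}"
  have K: "compact ?K" and cont: "continuous_on UNIV \<phi>"
    using \<phi> Ck_continuous by (auto simp: test_function_def)
  obtain B where B: "norm (\<phi> x) \<le> B" if "x \<in> ?K" for x
    using compact_continuous_image[OF continuous_on_subset[OF cont] K] compact_imp_bounded
    by (force simp: bounded_iff)
  have int: "integrable lebesgue (\<lambda>x. indicat_real ?K x *\<^sub>R w x)"
    using w K by (auto simp: L1_loc_def set_integrable_def)
  have eq: "of_real (\<phi> x) * w x = \<phi> x *\<^sub>R (indicat_real ?K x *\<^sub>R w x)" for x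
    using closure_subset[of "{x. \<phi> x \<noteq> 0}"] by (auto simp: indicator_def scaleR_conv_of_real)
  have \<phi>_meas: "\<phi> \<in> borel_measurable lebesgue"
    using borel_measurable_continuous_onI[OF cont]
    by (intro measurable_completion) simp
  show ?thesis
    unfolding eq
  proof (rule Bochner_Integration.integrable_bound)
    show "integrable lebesgue (\<lambda>x. B *\<^sub>R norm (indicat_real ?K x *\<^sub>R w x))"
      by (intro integrable_scaleR_right integrable_norm int)
    show "(\<lambda>x. \<phi> x *\<^sub>R (indicat_real ?K x *\<^sub>R w x)) \<in> borel_measurable lebesgue"
      by (intro borel_measurable_scaleR \<phi>_meas borel_measurable_integrable[OF int])
    show "AE x in lebesgue. norm (\<phi> x *\<^sub>R (indicat_real ?K x *\<^sub>R w x))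
        \<le> norm (B *\<^sub>R norm (indicat_real ?K x *\<^sub>R w x))"
    proof (rule AE_I2)
      fix x
      show "norm (\<phi> x *\<^sub>R (indicat_real ?K x *\<^sub>R w x)) \<le> norm (B *\<^sub>R norm (indicat_real ?K x *\<^sub>R w x))"
      proof (cases "x \<in> ?K")
        case True
        then show ?thesis using B[OF True] by (auto intro!: mult_right_mono)
      qed simp
    qed
  qed
qed

text \<open>Both weak derivatives move onto \<open>\<phi>\<close>, and the two minus signs
  cancel.\<close>

lemma weak_laplacian_test:
  fixes \<phi> :: "'a::euclidean_space \<Rightarrow> real"
  assumes u: "weak_laplacian u L" and \<phi>: "test_function \<phi>"
  shows "(LINT x|lebesgue. of_real (\<phi> x) * L x) = (LINT x|lebesgue. of_real (laplacian \<phi> x) * u x)"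
    and "integrable lebesgue (\<lambda>x. of_real (\<phi> x) * L x)"
    and "integrable lebesgue (\<lambda>x. of_real (laplacian \<phi> x) * u x)"
    and "L1_loc u"
proof -
  obtain v w where vw: "\<And>e. e \<in> Basis \<Longrightarrow> weak_partial e u (v e)"
      "\<And>e. e \<in> Basis \<Longrightarrow> weak_partial e (v e) (w e)" and L: "L = (\<lambda>x. \<Sum>e\<in>Basis. w e x)"
    using u by (auto simp: weak_laplacian_def)
  have test1: "test_function (partial_deriv e \<phi>)" if "e \<in> Basis" for e
    using test_function_partial_deriv[OF \<phi> that] .
  have test2: "test_function (partial_deriv e (partial_deriv e \<phi>))" if "e \<in> Basis" for e
    using test_function_partial_deriv[OF test1[OF that] that] .
  obtain e0 :: 'a where "e0 \<in> Basis" using nonempty_Basis by blast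
  then show u_loc: "L1_loc u" using vw(1) by (auto simp: weak_partial_def)
  have int_w: "integrable lebesgue (\<lambda>x. of_real (\<phi> x) * w e x)" if "e \<in> Basis" for e
    using vw(2)[OF that] by (intro test_function_mult_integrable[OF \<phi>]) (simp add: weak_partial_def)
  have int_u: "integrable lebesgue (\<lambda>x. of_real (partial_deriv e (partial_deriv e \<phi>) x) * u x)"
    if "e \<in> Basis" for e
    by (intro test_function_mult_integrable test2 that u_loc)
  have eqs: "(\<lambda>x. of_real (\<phi> x) * L x) = (\<lambda>x. \<Sum>e\<in>Basis. of_real (\<phi> x) * w e x)"
    "(\<lambda>x. of_real (laplacian \<phi> x) * u x)
       = (\<lambda>x. \<Sum>e\<in>Basis. of_real (partial_deriv e (partial_deriv e \<phi>) x) * u x)"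
    by (simp_all add: L laplacian_def sum_distrib_left sum_distrib_right)
  show "integrable lebesgue (\<lambda>x. of_real (\<phi> x) * L x)"
    "integrable lebesgue (\<lambda>x. of_real (laplacian \<phi> x) * u x)"
    unfolding eqs using int_w int_u by auto
  have "(LINT x|lebesgue. of_real (\<phi> x) * w e x)
      = (LINT x|lebesgue. of_real (partial_deriv e (partial_deriv e \<phi>) x) * u x)" if e: "e \<in> Basis" for e
    using vw(1)[OF e] vw(2)[OF e] \<phi> test1[OF e] by (auto simp: weak_partial_def)
  then show "(LINT x|lebesgue. of_real (\<phi> x) * L x) = (LINT x|lebesgue. of_real (laplacian \<phi> x) * u x)"
    unfolding eqs using int_w int_u by (simp add: Bochner_Integration.integral_sum)
qed

text \<open>Testing the equation with \<open>\<phi>\<close> moves the operator \<Delta> + k^2 q from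
  \<open>u\<close> to \<open>\<phi>\<close>, which it annihilates, so only the source k^2 (1 - q)
  \<open>uin\<close> on \<open>D\<close> is left. As \<open>\<phi>\<close> lacks compact support, it
  is first multiplied by a cutoff that is 1 on a ball containing \<open>D\<close>.\<close>

lemma nonscattering_orthogonal:
  fixes \<phi> :: "real \<times> real \<Rightarrow> real"
  assumes ns: "nonscattering k q D uin" and k: "k \<noteq> 0" and q: "q \<noteq> 1"
    and D: "open D" "bounded D" and uin: "continuous_on UNIV uin"
    and \<phi>: "\<And>n. Ck n \<phi>" "\<And>x. laplacian \<phi> x = - (k\<^sup>2 * q) * \<phi> x"
  shows "(LINT x|lebesgue. indicator D x * (of_real (\<phi> x) * uin x)) = 0"
proof -
  obtain u L where uL: "weak_laplacian u L" and u0: "AE x in lebesgue. x \<notin> D \<longrightarrow> u x = 0"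
    and eq: "AE x in lebesgue. L x + of_real (k\<^sup>2 * q) * u x
                             = of_real (k\<^sup>2 * (1 - q)) * uin x * indicator D x"
    using ns by (auto simp: nonscattering_def)
  obtain r where r: "\<And>x. x \<in> D \<Longrightarrow> norm x \<le> r" using D(2) by (auto simp: bounded_iff)
  obtain \<eta> :: "real \<times> real \<Rightarrow> real" where \<eta>: "\<And>n. Ck n \<eta>" "\<And>x. norm x \<le> r \<Longrightarrow> \<eta> x = 1"
      "bounded {x. \<eta> x \<noteq> 0}"
    using cutoff_exists[of r] by blast
  define \<psi> where "\<psi> x = \<eta> x * \<phi> x" for x
  have "bounded {x. \<psi> x \<noteq> 0}"
    using \<eta>(3) by (rule bounded_subset) (auto simp: \<psi>_def)
  moreover have "Ck n \<psi>" for n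
    unfolding \<psi>_def using \<eta>(1) \<phi>(1) by (rule Ck_mult)
  ultimately have \<psi>: "test_function \<psi>"
    by (simp add: test_function_def)
  have \<psi>D: "\<psi> x = \<phi> x" if "x \<in> D" for x using that r \<eta>(2) by (simp add: \<psi>_def)
  have lap: "laplacian \<psi> x = - (k\<^sup>2 * q) * \<psi> x" if "x \<in> D" for x
  proof -
    have "partial_deriv e (partial_deriv e \<psi>) x = partial_deriv e (partial_deriv e \<phi>) x" for e
      by (intro partial_deriv_cong_open[OF D(1) that] partial_deriv_cong_open[OF D(1)] \<psi>D)
    then have "laplacian \<psi> x = laplacian \<phi> x" by (simp add: laplacian_def)
    then show ?thesis using \<phi>(2) \<psi>D[OF that] by simp
  qed
  note W = weak_laplacian_test[OF uL \<psi>]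
  have int: "integrable lebesgue (\<lambda>x. of_real (\<psi> x) * u x)"
    by (intro test_function_mult_integrable \<psi> W(4))
  have meas: "(\<lambda>x. indicator D x * (of_real (\<phi> x) * uin x)) \<in> borel_measurable lebesgue"
  proof -
    have "(\<lambda>x. of_real (\<phi> x) * uin x) \<in> borel_measurable borel"
      using Ck_continuous[OF \<phi>(1)] uin
      by (intro borel_measurable_continuous_onI continuous_intros) auto
    from borel_measurable_times[OF borel_measurable_indicator this] D(1)
    have "(\<lambda>x. indicator D x * (of_real (\<phi> x) * uin x)) \<in> borel_measurable borel" by simp
    then show ?thesis by (intro measurable_completion) simp
  qed
  have "0 = (LINT x|(lebesgue :: (real \<times> real) measure). (0::complex))" by simp
  also have "\<dots> = (LINT x|lebesgue. of_real (laplacian \<psi> x) * u x + of_real (k\<^sup>2 * q) * (of_real (\<psi> x) * u x))"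
  proof (rule integral_cong_AE)
    \<comment> \<open>Outside \<open>D\<close> the factor \<open>u\<close> vanishes, which hides
      what the cutoff does to the Laplacian there.\<close>
    show "AE x in lebesgue. 0 = of_real (laplacian \<psi> x) * u x + of_real (k\<^sup>2 * q) * (of_real (\<psi> x) * u x)"
      using u0
    proof eventually_elim
      case (elim x)
      then show ?case by (cases "x \<in> D") (auto simp: lap algebra_simps)
    qed
  qed (use W(3) int in \<open>auto simp: borel_measurable_integrable\<close>)
  also have "\<dots> = (LINT x|lebesgue. of_real (\<psi> x) * L x + of_real (k\<^sup>2 * q) * (of_real (\<psi> x) * u x))"
    using W(1,2,3) int by simp
  also have "\<dots> = (LINT x|lebesgue. of_real (k\<^sup>2 * (1 - q)) * (indicator D x * (of_real (\<phi> x) * uin x)))"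
  proof (rule integral_cong_AE)
    show "AE x in lebesgue. of_real (\<psi> x) * L x + of_real (k\<^sup>2 * q) * (of_real (\<psi> x) * u x)
        = of_real (k\<^sup>2 * (1 - q)) * (indicator D x * (of_real (\<phi> x) * uin x))"
      using eq
    proof eventually_elim
      case (elim x)
      have "of_real (\<psi> x) * L x + of_real (k\<^sup>2 * q) * (of_real (\<psi> x) * u x)
          = of_real (\<psi> x) * (L x + of_real (k\<^sup>2 * q) * u x)" by (simp add: algebra_simps)
      then show ?case using elim \<psi>D[of x] by (auto simp: indicator_def)
    qed
  qed (use W(2) int meas in \<open>auto simp: borel_measurable_integrable\<close>)
  also have "\<dots> = of_real (k\<^sup>2 * (1 - q)) * (LINT x|lebesgue. indicator D x * (of_real (\<phi> x) * uin x))"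
    by simp
  finally show ?thesis using k q by simp
qed

section \<open>Green's formula on an ellipse\<close>

text \<open>\<open>ellipse_region\<close> is given topologically through \<open>inside\<close>. This
  closed ellipse has an explicit inequality, on which slicing can act, and differs from the region
  by a null set.\<close>

definition solid_ellipse :: "real \<Rightarrow> real \<Rightarrow> (real \<times> real) set" where
  "solid_ellipse a b = {(x, y). (x / a)\<^sup>2 + (y / b)\<^sup>2 \<le> 1}"

lemma solid_ellipse_eq_image:
  assumes "a > 0" "b > 0"
  shows "solid_ellipse a b = (\<lambda>(x, y). (a * x, b * y)) ` cball 0 1"
proof -
  have "(x, y) \<in> (\<lambda>(x, y). (a * x, b * y)) ` cball 0 1" if "(x / a)\<^sup>2 + (y / b)\<^sup>2 \<le> 1" for x y
    using that assms by (intro image_eqI[where x = "(x / a, y / b)"]) (auto simp: norm_Pair power_divide)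
  then show ?thesis using assms by (auto simp: solid_ellipse_def norm_Pair)
qed

lemma linear_scale_pair: "linear (\<lambda>(x, y). (a * x :: real, b * y :: real))"
  by (rule linearI) (auto simp: algebra_simps)

lemma inj_scale_pair: "a > 0 \<Longrightarrow> b > 0 \<Longrightarrow> inj (\<lambda>(x, y). (a * x :: real, b * y :: real))"
  by (auto simp: inj_on_def)

lemma ellipse_eq_image: "ellipse a b ` {-pi..pi} = (\<lambda>(x, y). (a * x, b * y)) ` sphere 0 1"
proof -
  have "p \<in> (\<lambda>t. (cos t, sin t)) ` {-pi..pi}" if "p \<in> sphere 0 1" for p :: "real \<times> real"
  proof -
    have "(fst p)\<^sup>2 + (snd p)\<^sup>2 = 1" using that by (simp add: norm_prod_def)
    then obtain t where t: "0 \<le> t" "t < 2 * pi" "fst p = cos t" "snd p = sin t"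
      using sincos_total_2pi by blast
    show ?thesis
    proof (cases "t \<le> pi")
      case True
      then show ?thesis using t by (intro image_eqI[of _ _ t]) (auto simp: prod_eq_iff)
    next
      case False
      then show ?thesis using t
        by (intro image_eqI[of _ _ "t - 2 * pi"]) (auto simp: prod_eq_iff cos_diff sin_diff)
    qed
  qed
  then have "sphere (0 :: real \<times> real) 1 = (\<lambda>t. (cos t, sin t)) ` {-pi..pi}"
    by (auto simp: norm_Pair)
  then show ?thesis by (auto simp: ellipse_def image_image)
qed

lemma compact_solid_ellipse: "a > 0 \<Longrightarrow> b > 0 \<Longrightarrow> compact (solid_ellipse a b)"
  unfolding solid_ellipse_eq_image
  by (auto intro!: compact_continuous_image continuous_intros simp: case_prod_beta)

text \<open>The curve is the frontier of a linear image of the unit disc, and for a bounded convex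
  set the inside of the frontier is the interior.\<close>

lemma ellipse_region_eq_interior:
  assumes "a > 0" "b > 0"
  shows "ellipse_region a b = interior (solid_ellipse a b)"
proof -
  let ?L = "\<lambda>(x, y). (a * x :: real, b * y :: real)"
  have "bij ?L"
    using linear_injective_imp_surjective[OF linear_scale_pair] inj_scale_pair[OF assms]
    by (simp add: bij_def)
  then have "frontier (?L ` cball 0 1) = ?L ` cball 0 1 - ?L ` ball 0 1"
    using compact_solid_ellipse[OF assms]
    unfolding solid_ellipse_eq_image[OF assms] frontier_def
    by (simp add: interior_bijective_linear_image linear_scale_pair compact_imp_closed)
  also have "\<dots> = ?L ` sphere 0 1"
    by (subst image_set_diff[symmetric]) (use inj_scale_pair[OF assms] cball_diff_eq_sphere in auto)
  finally have "frontier (solid_ellipse a b) = ellipse a b ` {-pi..pi}"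
    unfolding solid_ellipse_eq_image[OF assms] ellipse_eq_image .
  moreover have "convex (solid_ellipse a b)"
    unfolding solid_ellipse_eq_image[OF assms]
    by (intro convex_linear_image linear_scale_pair convex_cball)
  ultimately show ?thesis
    using inside_frontier_eq_interior[OF compact_imp_bounded[OF compact_solid_ellipse[OF assms]]]
    by (simp add: ellipse_region_def)
qed

lemma AE_ellipse_region_iff_solid:
  assumes "a > 0" "b > 0"
  shows "AE p in lebesgue. p \<in> ellipse_region a b \<longleftrightarrow> p \<in> solid_ellipse a b"
proof -
  have cl: "closed (solid_ellipse a b)" using compact_solid_ellipse[OF assms] by (rule compact_imp_closed)
  have "convex (solid_ellipse a b)"
    unfolding solid_ellipse_eq_image[OF assms]
    by (intro convex_linear_image linear_scale_pair convex_cball)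
  then have "frontier (solid_ellipse a b) \<in> null_sets lebesgue"
    using negligible_convex_frontier by (simp add: negligible_iff_null_sets)
  then have "AE p in lebesgue. p \<notin> frontier (solid_ellipse a b)" by (rule AE_not_in)
  then show ?thesis
    by eventually_elim (use cl interior_subset[of "solid_ellipse a b"] in
      \<open>auto simp: ellipse_region_eq_interior[OF assms] frontier_def closure_closed\<close>)
qed

text \<open>Fubini in horizontal slices: on the chord from \<open>- X y\<close> to
  \<open>X y\<close> the inner integral is a difference of boundary values. Then y = b sin t over a
  half period, where cos t \<ge> 0 and therefore X (b sin t) = a cos t.\<close>

lemma integral_solid_ellipse_deriv_fst:
  fixes A A1 :: "real \<times> real \<Rightarrow> complex"
  assumes ab: "a > 0" "b > 0" and A: "continuous_on UNIV A" and A1: "continuous_on UNIV A1"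
    and deriv: "\<And>x y. ((\<lambda>x. A (x, y)) has_vector_derivative A1 (x, y)) (at x)"
  shows "(LINT p|lborel. indicat_real (solid_ellipse a b) p *\<^sub>R A1 p)
    = integral {-pi/2..pi/2} (\<lambda>t. (b * cos t) *\<^sub>R (A (a * cos t, b * sin t) - A (- (a * cos t), b * sin t)))"
proof -
  let ?E = "solid_ellipse a b"
  define X where "X y = a * sqrt (1 - (y / b)\<^sup>2)" for y
  define h where "h y = A (X y, y) - A (- X y, y)" for y
  have int: "integrable lborel (\<lambda>p. indicat_real ?E p *\<^sub>R A1 p)"
    using compact_solid_ellipse[OF ab] continuous_on_subset[OF A1] by (intro borel_integrable_compact) auto
  have inner: "(LINT x|lborel. indicat_real ?E (x, y) *\<^sub>R A1 (x, y)) = indicat_real {-b..b} y *\<^sub>R h y" for y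
  proof -
    have "(y / b)\<^sup>2 \<le> 1 \<longleftrightarrow> \<bar>y / b\<bar> \<le> 1" by (rule abs_square_le_1)
    also have "\<dots> \<longleftrightarrow> \<bar>y\<bar> \<le> b" using ab by simp
    finally have yb: "(y / b)\<^sup>2 \<le> 1 \<longleftrightarrow> \<bar>y\<bar> \<le> b" .
    show ?thesis
    proof (cases "y \<in> {-b..b}")
      case True
      then have le: "(y / b)\<^sup>2 \<le> 1" by (simp add: yb abs_le_iff)
      have "(x / a)\<^sup>2 + (y / b)\<^sup>2 \<le> 1 \<longleftrightarrow> \<bar>x\<bar> \<le> X y" for x
      proof -
        have "\<bar>x\<bar> \<le> X y \<longleftrightarrow> \<bar>x / a\<bar> \<le> sqrt (1 - (y / b)\<^sup>2)"
          using ab by (simp add: X_def field_simps)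
        also have "\<dots> \<longleftrightarrow> (x / a)\<^sup>2 \<le> 1 - (y / b)\<^sup>2"
          using le real_sqrt_le_iff[of "(x / a)\<^sup>2" "1 - (y / b)\<^sup>2"] by simp
        finally show ?thesis by linarith
      qed
      then have "(x, y) \<in> ?E \<longleftrightarrow> x \<in> {- X y..X y}" for x
        by (simp add: solid_ellipse_def abs_le_iff) linarith
      then have ind: "indicat_real ?E (x, y) = indicat_real {- X y..X y} x" for x
        by (simp add: indicator_def)
      have "continuous_on {- X y..X y} (\<lambda>x. A1 (x, y))"
        by (intro continuous_on_compose2[OF A1] continuous_intros) auto
      moreover have "- X y \<le> X y" using ab le by (simp add: X_def)
      ultimately have "(LINT x|lborel. indicat_real {- X y..X y} x *\<^sub>R A1 (x, y)) = A (X y, y) - A (- X y, y)"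
        using deriv by (intro integral_FTC_atLeastAtMost) (auto intro: has_vector_derivative_at_within)
      then show ?thesis using True by (simp add: ind h_def)
    next
      case False
      then have "\<not> (y / b)\<^sup>2 \<le> 1" by (auto simp: yb)
      then have "(x, y) \<notin> ?E" for x
        using zero_le_power2[of "x / a"] unfolding solid_ellipse_def mem_Collect_eq case_prod_conv by linarith
      then show ?thesis using False by (simp add: indicator_def)
    qed
  qed
  have cont_h: "continuous_on {-b..b} h"
    unfolding h_def X_def using ab
    by (intro continuous_intros continuous_on_compose2[OF A]) auto
  have "(LINT p|lborel. indicat_real ?E p *\<^sub>R A1 p)
      = (LINT y|lborel. LINT x|lborel. indicat_real ?E (x, y) *\<^sub>R A1 (x, y))"
    using lborel_pair.integral_snd[of "\<lambda>x y. indicat_real ?E (x, y) *\<^sub>R A1 (x, y)"] int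
    by (simp add: lborel_prod case_prod_beta')
  also have "\<dots> = (LINT y:{-b..b}|lborel. h y)"
    by (simp add: inner set_lebesgue_integral_def)
  also have "\<dots> = integral {-b..b} h"
    using cont_h by (intro set_borel_integral_eq_integral) (auto simp: set_integrable_def intro!: borel_integrable_compact)
  also have "\<dots> = integral {-pi/2..pi/2} (\<lambda>t. (b * cos t) *\<^sub>R h (b * sin t))"
  proof -
    have "((\<lambda>t. (b * cos t) *\<^sub>R h (b * sin t)) has_integral (integral {b * sin (-pi/2)..b * sin (pi/2)} h)) {-pi/2..pi/2}"
    proof (rule has_integral_substitution[where c = "-b" and d = b])
      show "(\<lambda>t. b * sin t) ` {-pi/2..pi/2} \<subseteq> {-b..b}"
        using ab mult_left_mono[OF sin_ge_minus_one, of b] mult_left_mono[OF sin_le_one, of b] by auto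
    qed (use ab cont_h in \<open>auto intro!: derivative_eq_intros\<close>)
    then show ?thesis by (simp add: integral_unique)
  qed
  also have "\<dots> = integral {-pi/2..pi/2} (\<lambda>t. (b * cos t) *\<^sub>R (A (a * cos t, b * sin t) - A (- (a * cos t), b * sin t)))"
  proof (rule Henstock_Kurzweil_Integration.integral_cong)
    fix t :: real assume "t \<in> {-pi/2..pi/2}"
    then have "cos t \<ge> 0" by (intro cos_ge_zero) auto
    then have "X (b * sin t) = a * cos t" using ab by (simp add: X_def flip: cos_squared_eq)
    then show "(b * cos t) *\<^sub>R h (b * sin t) = (b * cos t) *\<^sub>R (A (a * cos t, b * sin t) - A (- (a * cos t), b * sin t))"
      by (simp add: h_def)
  qed
  finally show ?thesis .
qed

text \<open>The swap of coordinates turns this into the slicing in the other variable, with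
  \<open>a\<close> and \<open>b\<close> exchanged.\<close>

lemma integral_solid_ellipse_deriv_snd:
  fixes A A2 :: "real \<times> real \<Rightarrow> complex"
  assumes ab: "a > 0" "b > 0" and A: "continuous_on UNIV A" and A2: "continuous_on UNIV A2"
    and deriv: "\<And>x y. ((\<lambda>y. A (x, y)) has_vector_derivative A2 (x, y)) (at y)"
  shows "(LINT p|lborel. indicat_real (solid_ellipse a b) p *\<^sub>R A2 p)
    = integral {-pi/2..pi/2} (\<lambda>t. (a * cos t) *\<^sub>R (A (a * sin t, b * cos t) - A (a * sin t, - (b * cos t))))"
proof -
  have meas: "(\<lambda>p. indicat_real (solid_ellipse a b) p *\<^sub>R A2 p) \<in> borel_measurable (lborel \<Otimes>\<^sub>M lborel)"
    unfolding lborel_prod using compact_solid_ellipse[OF ab] continuous_on_subset[OF A2]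
    by (intro borel_measurable_integrable borel_integrable_compact) auto
  have "(LINT p|lborel. indicat_real (solid_ellipse a b) p *\<^sub>R A2 p)
      = (LINT p|lborel. indicat_real (solid_ellipse b a) p *\<^sub>R A2 (snd p, fst p))"
  proof -
    have "indicat_real (solid_ellipse a b) (snd p, fst p) = indicat_real (solid_ellipse b a) p" for p
      by (auto simp: solid_ellipse_def indicator_def add.commute)
    then show ?thesis
      using lborel_pair.integral_product_swap[OF meas] by (simp add: lborel_prod case_prod_beta')
  qed
  also have "\<dots> = integral {-pi/2..pi/2} (\<lambda>t. (a * cos t) *\<^sub>R (A (a * sin t, b * cos t) - A (a * sin t, - (b * cos t))))"
    by (subst integral_solid_ellipse_deriv_fst[where A = "\<lambda>p. A (snd p, fst p)"])
      (use ab deriv in \<open>auto intro!: continuous_on_compose2[OF A] continuous_on_compose2[OF A2] continuous_intros\<close>)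
  finally show ?thesis .
qed

lemma integral_reflect_shift:
  fixes h :: "real \<Rightarrow> 'a::euclidean_space"
  assumes "continuous_on {d - b..d - a} h"
  shows "integral {a..b} (\<lambda>t. h (d - t)) = integral {d - b..d - a} h"
proof -
  have "integral {a..b} (\<lambda>t. h (d - t)) = integral {-b..-a} (\<lambda>t. h (t + d))"
    using Henstock_Kurzweil_Integration.integral_reflect_real[of b a "\<lambda>t. h (d - t)"]
    by (simp add: add.commute)
  also have "\<dots> = integral {d - b..d - a} h"
    using integral_shift[of "-b" d "-a" h] assms by (simp add: o_def)
  finally show ?thesis .
qed

text \<open>The divergence theorem for (A, B), with outer normal times arc length (b cos t, a sin t)
  dt. The chord ends found by slicing lie at t and pi - t for \<open>A\<close>, at pi/2 - t and t -
  pi/2 for \<open>B\<close>; shifts, reflections and periodicity reassemble them to the full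
  curve.\<close>

lemma green_ellipse:
  fixes A A1 B B2 :: "real \<times> real \<Rightarrow> complex"
  assumes ab: "a > 0" "b > 0"
    and cont: "continuous_on UNIV A" "continuous_on UNIV A1" "continuous_on UNIV B" "continuous_on UNIV B2"
    and A: "\<And>x y. ((\<lambda>x. A (x, y)) has_vector_derivative A1 (x, y)) (at x)"
    and B: "\<And>x y. ((\<lambda>y. B (x, y)) has_vector_derivative B2 (x, y)) (at y)"
  shows "(LINT p|lborel. indicat_real (solid_ellipse a b) p *\<^sub>R (A1 p + B2 p))
    = integral {-pi..pi} (\<lambda>t. (b * cos t) *\<^sub>R A (ellipse a b t) + (a * sin t) *\<^sub>R B (ellipse a b t))"
proof -
  have int: "integrable lborel (\<lambda>p. indicat_real (solid_ellipse a b) p *\<^sub>R A1 p)"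
    "integrable lborel (\<lambda>p. indicat_real (solid_ellipse a b) p *\<^sub>R B2 p)"
    using compact_solid_ellipse[OF ab] continuous_on_subset[OF cont(2)] continuous_on_subset[OF cont(4)]
    by (auto intro!: borel_integrable_compact)
  define h1 where "h1 t = (b * cos t) *\<^sub>R A (ellipse a b t)" for t
  define h2 where "h2 t = (a * sin t) *\<^sub>R B (ellipse a b t)" for t
  have h: "continuous_on S h1" "continuous_on S h2" for S
    unfolding h1_def h2_def ellipse_def
    by (intro continuous_intros continuous_on_compose2[OF cont(1)] continuous_on_compose2[OF cont(3)]; simp)+
  have hi: "h1 integrable_on {x..y}" "h2 integrable_on {x..y}" for x y
    using h by (auto intro: integrable_continuous_real)
  have "(LINT p|lborel. indicat_real (solid_ellipse a b) p *\<^sub>R A1 p)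
      = integral {-pi/2..pi/2} (\<lambda>t. h1 t + h1 (pi - t))"
    unfolding integral_solid_ellipse_deriv_fst[OF ab cont(1,2) A]
    by (simp add: h1_def ellipse_def algebra_simps)
  also have "\<dots> = integral {-pi/2..pi/2} h1 + integral {-pi/2..pi/2} (\<lambda>t. h1 (pi - t))"
    by (intro Henstock_Kurzweil_Integration.integral_add hi integrable_continuous_real
        continuous_on_compose2[OF h(1)[of UNIV]] continuous_intros) auto
  also have "integral {-pi/2..pi/2} (\<lambda>t. h1 (pi - t)) = integral {pi/2..3*pi/2} h1"
    by (subst integral_reflect_shift) (auto intro: h simp: field_simps)
  also have "\<dots> = integral {pi/2..pi} h1 + integral {pi..3*pi/2} h1"
    by (rule Henstock_Kurzweil_Integration.integral_combine[symmetric]) (auto intro: hi)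
  also have "integral {pi..3*pi/2} h1 = integral {-pi..-pi/2} (\<lambda>t. h1 (t + 2 * pi))"
    using integral_shift[of "-pi" "2*pi" "-pi/2" h1] h by (simp add: o_def)
  also have "\<dots> = integral {-pi..-pi/2} h1"
    by (intro Henstock_Kurzweil_Integration.integral_cong) (simp add: h1_def ellipse_def)
  finally have 1: "(LINT p|lborel. indicat_real (solid_ellipse a b) p *\<^sub>R A1 p) = integral {-pi..pi} h1"
    using Henstock_Kurzweil_Integration.integral_combine[of "-pi" "-pi/2" "pi/2" h1, symmetric]
      Henstock_Kurzweil_Integration.integral_combine[of "-pi" "pi/2" "pi" h1, symmetric] hi
    by (simp add: add_ac)
  have "(LINT p|lborel. indicat_real (solid_ellipse a b) p *\<^sub>R B2 p)
      = integral {-pi/2..pi/2} (\<lambda>t. h2 (pi/2 - t) + h2 (t - pi/2))"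
    unfolding integral_solid_ellipse_deriv_snd[OF ab cont(3,4) B]
    by (simp add: h2_def ellipse_def cos_diff sin_diff algebra_simps)
  also have "\<dots> = integral {-pi/2..pi/2} (\<lambda>t. h2 (pi/2 - t)) + integral {-pi/2..pi/2} (\<lambda>t. h2 (t - pi/2))"
    by (intro Henstock_Kurzweil_Integration.integral_add hi integrable_continuous_real
        continuous_on_compose2[OF h(2)[of UNIV]] continuous_intros) auto
  also have "integral {-pi/2..pi/2} (\<lambda>t. h2 (pi/2 - t)) = integral {0..pi} h2"
    by (subst integral_reflect_shift) (auto intro: h)
  also have "integral {-pi/2..pi/2} (\<lambda>t. h2 (t - pi/2)) = integral {-pi..0} h2"
    using integral_shift[of "-pi/2" "-pi/2" "pi/2" h2] h by (simp add: o_def)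
  finally have 2: "(LINT p|lborel. indicat_real (solid_ellipse a b) p *\<^sub>R B2 p) = integral {-pi..pi} h2"
    using Henstock_Kurzweil_Integration.integral_combine[of "-pi" 0 pi h2] hi by (simp add: add_ac)
  have "(LINT p|lborel. indicat_real (solid_ellipse a b) p *\<^sub>R (A1 p + B2 p))
      = integral {-pi..pi} h1 + integral {-pi..pi} h2"
    using int by (simp add: scaleR_add_right 1[symmetric] 2[symmetric])
  also have "\<dots> = integral {-pi..pi} (\<lambda>t. h1 t + h2 t)"
    by (intro Henstock_Kurzweil_Integration.integral_add[symmetric] hi)
  finally show ?thesis by (simp add: h1_def h2_def)
qed

section \<open>The boundary identity for exponential solutions\<close>

definition zpos :: "real \<Rightarrow> real \<Rightarrow> complex \<Rightarrow> complex" where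
  "zpos a b t = of_real a * cos t + \<i> * of_real b * sin t"

text \<open>At real \<open>t\<close> this is the conjugate of \<open>zpos\<close>. At complex
  \<open>t\<close> it is the holomorphic continuation of that conjugate, which is no longer
  conjugate to \<open>zpos\<close>.\<close>

definition zneg :: "real \<Rightarrow> real \<Rightarrow> complex \<Rightarrow> complex" where
  "zneg a b t = of_real a * cos t - \<i> * of_real b * sin t"

definition zpos' :: "real \<Rightarrow> real \<Rightarrow> complex \<Rightarrow> complex" where
  "zpos' a b t = - of_real a * sin t + \<i> * of_real b * cos t"

definition zneg' :: "real \<Rightarrow> real \<Rightarrow> complex \<Rightarrow> complex" where
  "zneg' a b t = - of_real a * sin t - \<i> * of_real b * cos t"

definition dz :: "(real \<times> real \<Rightarrow> complex) \<Rightarrow> real \<times> real \<Rightarrow> complex" where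
  "dz u p = (partial_deriv (1, 0) u p - \<i> * partial_deriv (0, 1) u p) / 2"

lemma Basis_real_pair: "Basis = {(1, 0), (0, 1) :: real \<times> real}"
  by (auto simp: Basis_prod_def)

lemma laplacian_real_pair:
  "laplacian f p = partial_deriv (1, 0) (partial_deriv (1, 0) f) p
     + partial_deriv (0, 1) (partial_deriv (0, 1) f) (p :: real \<times> real)"
  by (simp add: laplacian_def Basis_real_pair)

text \<open>The prefactor \<open>c\<close> makes both rules applicable again to the first
  derivatives they produce.\<close>

lemma exp_cos_has_derivative:
  fixes p :: "real \<times> real"
  shows "((\<lambda>p. c * (exp (\<alpha> * fst p) * cos (\<beta> * snd p + d))) has_derivative
      (\<lambda>h. c * (\<alpha> * fst h * (exp (\<alpha> * fst p) * cos (\<beta> * snd p + d))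
        - \<beta> * snd h * (exp (\<alpha> * fst p) * sin (\<beta> * snd p + d))))) (at p)"
    and "((\<lambda>p. c * (exp (\<alpha> * fst p) * sin (\<beta> * snd p + d))) has_derivative
      (\<lambda>h. c * (\<alpha> * fst h * (exp (\<alpha> * fst p) * sin (\<beta> * snd p + d))
        + \<beta> * snd h * (exp (\<alpha> * fst p) * cos (\<beta> * snd p + d))))) (at p)"
  by (auto intro!: derivative_eq_intros simp: algebra_simps)

lemma exp_cos_Ck: "Ck n (\<lambda>p :: real \<times> real. exp (\<alpha> * fst p) * cos (\<beta> * snd p + d))"
  by (intro Ck_mult[OF Ck_exp Ck_cos_add] Ck_mult[OF Ck_const Ck_bounded_linear[OF bounded_linear_fst]]
      Ck_mult[OF Ck_const Ck_bounded_linear[OF bounded_linear_snd]])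

lemma exp_cos_laplacian:
  "laplacian (\<lambda>p :: real \<times> real. exp (\<alpha> * fst p) * cos (\<beta> * snd p + d)) p
    = (\<alpha>\<^sup>2 - \<beta>\<^sup>2) * (exp (\<alpha> * fst p) * cos (\<beta> * snd p + d))"
proof -
  have 1: "partial_deriv (1, 0) (\<lambda>p :: real \<times> real. exp (\<alpha> * fst p) * cos (\<beta> * snd p + d))
      = (\<lambda>p. \<alpha> * (exp (\<alpha> * fst p) * cos (\<beta> * snd p + d)))"
    using partial_deriv_eqI[OF exp_cos_has_derivative(1)[of 1]] by auto
  have 2: "partial_deriv (0, 1) (\<lambda>p :: real \<times> real. exp (\<alpha> * fst p) * cos (\<beta> * snd p + d))
      = (\<lambda>p. (- \<beta>) * (exp (\<alpha> * fst p) * sin (\<beta> * snd p + d)))"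
    using partial_deriv_eqI[OF exp_cos_has_derivative(1)[of 1]] by auto
  show ?thesis
    unfolding laplacian_real_pair 1 2 partial_deriv_eqI[OF exp_cos_has_derivative(1)]
      partial_deriv_eqI[OF exp_cos_has_derivative(2)]
    by (simp add: algebra_simps power2_eq_square)
qed

lemma integral_ellipse_region_eq_solid:
  fixes g :: "real \<times> real \<Rightarrow> complex"
  assumes ab: "a > 0" "b > 0" and g: "continuous_on UNIV g"
  shows "(LINT p|lebesgue. indicator (ellipse_region a b) p * g p)
    = (LINT p|lborel. indicat_real (solid_ellipse a b) p *\<^sub>R g p)"
proof -
  let ?D = "ellipse_region a b" and ?E = "solid_ellipse a b"
  have "?D \<in> sets borel" using ellipse_region_eq_interior[OF ab] by simp
  then have D: "(\<lambda>p. indicator ?D p * g p) \<in> borel_measurable lborel"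
    using borel_measurable_continuous_onI[OF g] by (intro borel_measurable_times borel_measurable_indicator) auto
  have E: "(\<lambda>p. indicat_real ?E p *\<^sub>R g p) \<in> borel_measurable lborel"
    using compact_solid_ellipse[OF ab] continuous_on_subset[OF g]
    by (intro borel_measurable_integrable borel_integrable_compact) auto
  have "(LINT p|lebesgue. indicator ?D p * g p) = (LINT p|lebesgue. indicat_real ?E p *\<^sub>R g p)"
  proof (rule integral_cong_AE)
    show "AE p in lebesgue. indicator ?D p * g p = indicat_real ?E p *\<^sub>R g p"
      using AE_ellipse_region_iff_solid[OF ab] by eventually_elim (auto simp: indicator_def)
  qed (use D E in \<open>auto intro: measurable_completion\<close>)
  also have "\<dots> = (LINT p|lborel. indicat_real ?E p *\<^sub>R g p)"
    by (rule integral_completion[OF E])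
  finally show ?thesis .
qed

lemma linear_real_pair:
  fixes x y :: real
  assumes "(f has_derivative D) (at p)"
  shows "D (x, y) = x *\<^sub>R D (1, 0) + y *\<^sub>R D (0, 1)"
proof -
  have "linear D" using assms has_derivative_linear by blast
  then have "D (x *\<^sub>R (1, 0) + y *\<^sub>R (0, 1)) = x *\<^sub>R D (1, 0) + y *\<^sub>R D (0, 1)"
    by (simp only: linear_add linear_scale)
  then show ?thesis by simp
qed

lemma has_vector_derivative_fst_line:
  fixes f :: "real \<times> real \<Rightarrow> complex"
  assumes "(f has_derivative D) (at (x, y))"
  shows "((\<lambda>x. f (x, y)) has_vector_derivative D (1, 0)) (at x)"
proof -
  have "((\<lambda>x. f (x, y)) has_derivative (\<lambda>h. D (h, 0))) (at x)"
    using assms by (intro has_derivative_compose[of "\<lambda>x. (x, y)" "\<lambda>h. (h, 0)" x UNIV f])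
      (auto intro!: derivative_eq_intros)
  moreover have "(\<lambda>h. D (h, 0)) = (\<lambda>h. h *\<^sub>R D (1, 0))"
    using linear_real_pair[OF assms, of _ 0] by (intro ext) (metis add.right_neutral scale_zero_left)
  ultimately show ?thesis unfolding has_vector_derivative_def by (rule has_derivative_eq_rhs)
qed

lemma has_vector_derivative_snd_line:
  fixes f :: "real \<times> real \<Rightarrow> complex"
  assumes "(f has_derivative D) (at (x, y))"
  shows "((\<lambda>y. f (x, y)) has_vector_derivative D (0, 1)) (at y)"
proof -
  have "((\<lambda>y. f (x, y)) has_derivative (\<lambda>h. D (0, h))) (at y)"
    using assms by (intro has_derivative_compose[of "\<lambda>y. (x, y)" "\<lambda>h. (0, h)" y UNIV f])
      (auto intro!: derivative_eq_intros)
  moreover have "(\<lambda>h. D (0, h)) = (\<lambda>h. h *\<^sub>R D (0, 1))"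
    using linear_real_pair[OF assms, of 0] by (intro ext) (metis add.left_neutral scale_zero_left)
  ultimately show ?thesis unfolding has_vector_derivative_def by (rule has_derivative_eq_rhs)
qed

lemma has_vector_derivative_ellipse:
  fixes f :: "real \<times> real \<Rightarrow> complex"
  assumes "(f has_derivative D) (at (ellipse a b t))"
  shows "((\<lambda>t. f (ellipse a b t)) has_vector_derivative
    - of_real (a * sin t) * D (1, 0) + of_real (b * cos t) * D (0, 1)) (at t)"
proof -
  have "((\<lambda>t. f (ellipse a b t)) has_derivative (\<lambda>h. D (h * - (a * sin t), h * (b * cos t)))) (at t)"
    using assms unfolding ellipse_def
    by (intro has_derivative_compose[of "\<lambda>t. (a * cos t, b * sin t)" "\<lambda>h. (h * - (a * sin t), h * (b * cos t))" t UNIV f])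
      (auto intro!: derivative_eq_intros)
  moreover have "D (h * - (a * sin t), h * (b * cos t))
      = h *\<^sub>R (- of_real (a * sin t) * D (1, 0) + of_real (b * cos t) * D (0, 1))" for h
    unfolding linear_real_pair[OF assms, of "h * - (a * sin t)"]
    by (simp add: scaleR_conv_of_real algebra_simps)
  ultimately show ?thesis by (simp add: has_vector_derivative_def)
qed

lemma incident_wave_derivatives:
  assumes "incident_wave k u"
  shows "(u has_derivative (\<lambda>e. partial_deriv e u p)) (at p)"
    and "e \<in> Basis \<Longrightarrow> (partial_deriv e u has_derivative (\<lambda>e'. partial_deriv e' (partial_deriv e u) p)) (at p)"
    and "e \<in> Basis \<Longrightarrow> e' \<in> Basis \<Longrightarrow> continuous_on UNIV (partial_deriv e' (partial_deriv e u))"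
    and "e \<in> Basis \<Longrightarrow> continuous_on UNIV (partial_deriv e u)"
    and "continuous_on UNIV u"
proof -
  have C: "Ck (Suc (Suc 0)) u" using assms by (simp add: incident_wave_def numeral_2_eq_2)
  then show "(u has_derivative (\<lambda>e. partial_deriv e u p)) (at p)" by (rule Ck_Suc_has_derivative)
  have C1: "Ck (Suc 0) (partial_deriv e u)" if "e \<in> Basis" for e
    using C that by (metis Ck.simps(2))
  show "(partial_deriv e u has_derivative (\<lambda>e'. partial_deriv e' (partial_deriv e u) p)) (at p)" if "e \<in> Basis"
    using C1[OF that] by (rule Ck_Suc_has_derivative)
  show "continuous_on UNIV (partial_deriv e' (partial_deriv e u))" if "e \<in> Basis" "e' \<in> Basis"
    using C1[OF that(1)] that(2) by simp
  show "continuous_on UNIV (partial_deriv e u)" if "e \<in> Basis"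
    using C1[OF that] by (rule Ck_continuous)
  show "continuous_on UNIV u" using C by (rule Ck_continuous)
qed

text \<open>Let v be the exponential and N the outer normal derivative. Green's second identity and
  the orthogonality of u and v on the ellipse give a vanishing boundary integral of u Nv - v Nu.
  Adding \<i> times the exact derivative of u v along the curve, whose integral is also 0, leaves 2
  \<i> times (u v_w W' + v u_z Z'), and v_w = \<mu> v.\<close>

lemma boundary_identity:
  assumes ab: "a > 0" "b > 0" and k: "k \<noteq> 0" and q: "q \<noteq> 1" and inc: "incident_wave k u"
    and ns: "nonscattering k q (ellipse_region a b) u" and mu: "4 * l * \<mu> = - (k\<^sup>2 * q)"
  shows "((\<lambda>t. exp (of_real l * zpos a b (of_real t) + of_real \<mu> * zneg a b (of_real t))
      * (of_real \<mu> * zneg' a b (of_real t) * u (ellipse a b t)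
        + zpos' a b (of_real t) * dz u (ellipse a b t))) has_integral 0) {-pi..pi}"
proof -
  define \<alpha> where "\<alpha> = l + \<mu>"
  define \<beta> where "\<beta> = l - \<mu>"
  have ab2: "\<alpha>\<^sup>2 - \<beta>\<^sup>2 = - (k\<^sup>2 * q)"
    using mu by (simp add: \<alpha>_def \<beta>_def power2_eq_square algebra_simps)
  define v where "v p = exp (of_real \<alpha> * of_real (fst p) + \<i> * of_real \<beta> * of_real (snd p))" for p :: "real \<times> real"
  \<comment> \<open>Test functions are real valued, so orthogonality is used for the real and the
    imaginary part separately. The phase - pi / 2 writes the sine as a member of the same cosine
    family.\<close>
  have v_split: "v p = of_real (exp (\<alpha> * fst p) * cos (\<beta> * snd p + 0))
      + \<i> * of_real (exp (\<alpha> * fst p) * cos (\<beta> * snd p + - (pi / 2)))" for p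
    by (simp add: v_def complex_eq_iff Re_exp Im_exp cos_diff)
  note I = incident_wave_derivatives[OF inc]
  have bas: "(1, 0) \<in> (Basis :: (real \<times> real) set)" "(0, 1) \<in> (Basis :: (real \<times> real) set)" by (simp_all add: Basis_real_pair)
  let ?u1 = "partial_deriv (1, 0) u" and ?u2 = "partial_deriv (0, 1) u"
  let ?u11 = "partial_deriv (1, 0) ?u1" and ?u22 = "partial_deriv (0, 1) ?u2"
  have v_cont: "continuous_on UNIV v" unfolding v_def by (intro continuous_intros)
  have v_der: "(v has_derivative (\<lambda>h. v p * (of_real \<alpha> * of_real (fst h) + \<i> * of_real \<beta> * of_real (snd h)))) (at p)" for p
  proof -
    let ?L = "\<lambda>h. of_real \<alpha> * of_real (fst h) + \<i> * of_real \<beta> * of_real (snd h :: real)"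
    have "(?L has_derivative ?L) (at p)" by (auto intro!: derivative_eq_intros)
    moreover have "(exp has_derivative (*) (exp (?L p))) (at (?L p))"
      using DERIV_exp[of "?L p"] by (simp add: has_field_derivative_def)
    ultimately show ?thesis unfolding v_def by (rule has_derivative_compose)
  qed
  have zero: "(LINT p|lborel. indicat_real (solid_ellipse a b) p *\<^sub>R (v p * u p)) = 0"
  proof -
    define e where "e d p = complex_of_real (exp (\<alpha> * fst p) * cos (\<beta> * snd p + d)) * u p" for d :: real and p :: "real \<times> real"
    have e_cont: "continuous_on UNIV (e d)" for d
      unfolding e_def by (intro continuous_intros I(5))
    have D: "open (ellipse_region a b)" "bounded (ellipse_region a b)"
      using compact_imp_bounded[OF compact_solid_ellipse[OF ab]] interior_subset
      by (auto simp: ellipse_region_eq_interior[OF ab] intro: bounded_subset)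
    have e0: "(LINT p|lborel. indicat_real (solid_ellipse a b) p *\<^sub>R e d p) = 0" for d
      unfolding integral_ellipse_region_eq_solid[OF ab e_cont, symmetric] unfolding e_def
      using nonscattering_orthogonal[OF ns k q D I(5) exp_cos_Ck]
      by (simp only: exp_cos_laplacian ab2)
    have int: "integrable lborel (\<lambda>p. indicat_real (solid_ellipse a b) p *\<^sub>R e d p)" for d
      using compact_solid_ellipse[OF ab] continuous_on_subset[OF e_cont] by (intro borel_integrable_compact) auto
    have eq: "indicat_real (solid_ellipse a b) p *\<^sub>R (v p * u p) = indicat_real (solid_ellipse a b) p *\<^sub>R e 0 p
        + \<i> * (indicat_real (solid_ellipse a b) p *\<^sub>R e (- (pi / 2)) p)" for p
      by (simp only: v_split e_def) (simp add: algebra_simps)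
    show ?thesis
      unfolding eq
      by (subst Bochner_Integration.integral_add)
        (use int e0 in \<open>simp_all del: mult_scaleR_right\<close>)
  qed
  \<comment> \<open>The field (A, B) is u grad v - v grad u. The products of first derivatives
    cancel inside each component, and A1 + B2 = u \<Delta>v - v \<Delta>u is a multiple of u
    v.\<close>
  define A where "A p = u p * (of_real \<alpha> * v p) - v p * ?u1 p" for p
  define A1 where "A1 p = of_real (\<alpha>\<^sup>2) * (v p * u p) - v p * ?u11 p" for p
  define B where "B p = u p * (\<i> * of_real \<beta> * v p) - v p * ?u2 p" for p
  define B2 where "B2 p = - of_real (\<beta>\<^sup>2) * (v p * u p) - v p * ?u22 p" for p
  have cont: "continuous_on UNIV A" "continuous_on UNIV A1" "continuous_on UNIV B" "continuous_on UNIV B2"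
    unfolding A_def A1_def B_def B2_def by (intro continuous_intros v_cont I bas)+
  have dA: "((\<lambda>x. A (x, y)) has_vector_derivative A1 (x, y)) (at x)" for x y
  proof -
    have "((\<lambda>x. A (x, y)) has_vector_derivative
        (u (x, y) * (of_real \<alpha> * (v (x, y) * (of_real \<alpha> * of_real (fst (1 :: real, 0 :: real)) + \<i> * of_real \<beta> * of_real (snd (1 :: real, 0 :: real)))))
          + ?u1 (x, y) * (of_real \<alpha> * v (x, y)))
        - (v (x, y) * ?u11 (x, y)
          + v (x, y) * (of_real \<alpha> * of_real (fst (1 :: real, 0 :: real)) + \<i> * of_real \<beta> * of_real (snd (1 :: real, 0 :: real))) * ?u1 (x, y))) (at x)"
      unfolding A_def
      by (intro has_vector_derivative_diff has_vector_derivative_mult has_vector_derivative_mult_right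
          has_vector_derivative_fst_line[OF I(1)] has_vector_derivative_fst_line[OF v_der]
          has_vector_derivative_fst_line[OF I(2)[OF bas(1)]])
    then show ?thesis
      by (rule has_vector_derivative_eq_rhs) (simp add: A1_def algebra_simps power2_eq_square)
  qed
  have dB: "((\<lambda>y. B (x, y)) has_vector_derivative B2 (x, y)) (at y)" for x y
  proof -
    have "((\<lambda>y. B (x, y)) has_vector_derivative
        (u (x, y) * (\<i> * of_real \<beta> * (v (x, y) * (of_real \<alpha> * of_real (fst (0 :: real, 1 :: real)) + \<i> * of_real \<beta> * of_real (snd (0 :: real, 1 :: real)))))
          + ?u2 (x, y) * (\<i> * of_real \<beta> * v (x, y)))
        - (v (x, y) * ?u22 (x, y)
          + v (x, y) * (of_real \<alpha> * of_real (fst (0 :: real, 1 :: real)) + \<i> * of_real \<beta> * of_real (snd (0 :: real, 1 :: real))) * ?u2 (x, y))) (at y)"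
      unfolding B_def
      by (intro has_vector_derivative_diff has_vector_derivative_mult has_vector_derivative_mult_right
          has_vector_derivative_snd_line[OF I(1)] has_vector_derivative_snd_line[OF v_der]
          has_vector_derivative_snd_line[OF I(2)[OF bas(2)]])
    then show ?thesis
      by (rule has_vector_derivative_eq_rhs) (simp add: B2_def algebra_simps power2_eq_square)
  qed
  have sum: "A1 p + B2 p = of_real (k\<^sup>2 * (1 - q)) * (v p * u p)" for p
  proof -
    have "?u11 p + ?u22 p = - of_real (k\<^sup>2) * u p"
    proof -
      have "laplacian u p + of_real (k\<^sup>2) * u p = 0"
        using inc unfolding incident_wave_def by blast
      then show ?thesis by (simp add: laplacian_real_pair eq_neg_iff_add_eq_0)
    qed
    moreover have "A1 p + B2 p = of_real (\<alpha>\<^sup>2 - \<beta>\<^sup>2) * (v p * u p) - v p * (?u11 p + ?u22 p)"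
      by (simp add: A1_def B2_def algebra_simps)
    ultimately show ?thesis by (simp add: ab2 algebra_simps)
  qed
  have "integral {-pi..pi} (\<lambda>t. (b * cos t) *\<^sub>R A (ellipse a b t) + (a * sin t) *\<^sub>R B (ellipse a b t)) = 0"
    unfolding green_ellipse[OF ab cont dA dB, symmetric] sum
    using zero by (simp add: mult_scaleR_right[symmetric] del: mult_scaleR_right)
  moreover have "(\<lambda>t. (b * cos t) *\<^sub>R A (ellipse a b t) + (a * sin t) *\<^sub>R B (ellipse a b t)) integrable_on {-pi..pi}"
    unfolding ellipse_def
    by (intro integrable_continuous_real continuous_intros continuous_on_compose2[OF cont(1)] continuous_on_compose2[OF cont(3)]) auto
  ultimately have g: "((\<lambda>t. (b * cos t) *\<^sub>R A (ellipse a b t) + (a * sin t) *\<^sub>R B (ellipse a b t)) has_integral 0) {-pi..pi}"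
    by (simp add: has_integral_iff)
  \<comment> \<open>The derivative of u v along the curve; its integral vanishes by
    periodicity.\<close>
  define E' where "E' t = u (ellipse a b t) * (- of_real (a * sin t) * (v (ellipse a b t) * of_real \<alpha>)
      + of_real (b * cos t) * (v (ellipse a b t) * (\<i> * of_real \<beta>)))
      + (- of_real (a * sin t) * ?u1 (ellipse a b t) + of_real (b * cos t) * ?u2 (ellipse a b t)) * v (ellipse a b t)" for t
  have "((\<lambda>t. u (ellipse a b t) * v (ellipse a b t)) has_vector_derivative E' t) (at t)" for t
    unfolding E'_def
    by (rule has_vector_derivative_eq_rhs,
        rule has_vector_derivative_mult[OF has_vector_derivative_ellipse[OF I(1)] has_vector_derivative_ellipse[OF v_der]])
      simp
  then have "(E' has_integral (u (ellipse a b pi) * v (ellipse a b pi) - u (ellipse a b (-pi)) * v (ellipse a b (-pi)))) {-pi..pi}"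
    by (intro fundamental_theorem_of_calculus) (auto intro: has_vector_derivative_at_within)
  then have e: "(E' has_integral 0) {-pi..pi}" by (simp add: ellipse_def)
  have "((\<lambda>t. ((b * cos t) *\<^sub>R A (ellipse a b t) + (a * sin t) *\<^sub>R B (ellipse a b t) + \<i> * E' t) * (1 / (2 * \<i>)))
      has_integral (0 + \<i> * 0) * (1 / (2 * \<i>))) {-pi..pi}"
    by (intro has_integral_mult_left has_integral_add g has_integral_mult_right e)
  moreover have "((b * cos t) *\<^sub>R A (ellipse a b t) + (a * sin t) *\<^sub>R B (ellipse a b t) + \<i> * E' t) * (1 / (2 * \<i>))
      = exp (of_real l * zpos a b (of_real t) + of_real \<mu> * zneg a b (of_real t))
      * (of_real \<mu> * zneg' a b (of_real t) * u (ellipse a b t)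
        + zpos' a b (of_real t) * dz u (ellipse a b t))" for t
  proof -
    have v: "exp (of_real l * zpos a b (of_real t) + of_real \<mu> * zneg a b (of_real t)) = v (ellipse a b t)"
      by (simp add: v_def zpos_def zneg_def ellipse_def \<alpha>_def \<beta>_def cos_of_real sin_of_real algebra_simps)
    show ?thesis
      unfolding v by (simp add: A_def B_def E'_def scaleR_conv_of_real \<alpha>_def \<beta>_def zpos'_def zneg'_def dz_def
          cos_of_real sin_of_real field_simps)
  qed
  ultimately show ?thesis by simp
qed

section \<open>Analytic functions of two complex variables\<close>

text \<open>m (r / R)^m tends to 0 and is therefore bounded. This lets the terms of a differentiated
  series on the radius \<open>r\<close> be dominated by terms of the original series on the larger
  radius \<open>R\<close>.\<close>

lemma mult_power_le_geometric:
  assumes "0 < r" "r < R"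
  obtains K :: real where "K > 0" "\<And>m. real m * r ^ (m - 1) \<le> K * R ^ m" "\<And>m. r ^ m \<le> R ^ m"
proof -
  have "(\<lambda>m. of_nat m * (r / R) ^ m) \<longlonglongrightarrow> 0"
    using assms by (intro powser_times_n_limit_0) auto
  then have "Bseq (\<lambda>m. real m * (r / R) ^ m)" by (auto intro: convergent_imp_Bseq convergentI)
  then obtain C where C: "C > 0" "\<And>m. norm (real m * (r / R) ^ m) \<le> C" by (auto simp: Bseq_def)
  show ?thesis
  proof (rule that[of "C / r"])
    show "C / r > 0" using C assms by simp
    show "real m * r ^ (m - 1) \<le> C / r * R ^ m" for m
    proof (cases m)
      case 0
      then show ?thesis using C assms by simp
    next
      case (Suc j)
      have "real m * (r / R) ^ m \<le> C" using C(2)[of m] by simp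
      then have "real m * r ^ m \<le> C * R ^ m" using assms by (simp add: power_divide field_simps)
      then show ?thesis using assms by (simp add: Suc field_simps)
    qed
    show "r ^ m \<le> R ^ m" for m using assms by (intro power_mono) auto
  qed
qed

text \<open>Termwise differentiation. For complex terms unordered summability is absolute
  summability, so convergence at the single point (z0 + R, w0 + R) gives a summable majorant, and
  with \<open>mult_power_le_geometric\<close> one for both families of partial derivatives,
  uniformly on a smaller polydisc.\<close>

lemma power_series2_has_derivative:
  fixes c :: "nat \<Rightarrow> nat \<Rightarrow> complex"
  assumes F: "\<And>z w. norm (z - z0) < \<rho> \<Longrightarrow> norm (w - w0) < \<rho> \<Longrightarrow>
      ((\<lambda>(m, n). c m n * (z - z0) ^ m * (w - w0) ^ n) has_sum F (z, w)) UNIV"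
    and z: "norm (z - z0) < \<rho>" and w: "norm (w - w0) < \<rho>"
  obtains S1 S2 where
    "((\<lambda>(m, n). of_nat (Suc m) * c (Suc m) n * (z - z0) ^ m * (w - w0) ^ n) has_sum S1) UNIV"
    "((\<lambda>(m, n). of_nat (Suc n) * c m (Suc n) * (z - z0) ^ m * (w - w0) ^ n) has_sum S2) UNIV"
    "(F has_derivative (\<lambda>h. S1 * fst h + S2 * snd h)) (at (z, w))"
proof -
  define r0 where "r0 = max (norm (z - z0)) (norm (w - w0))"
  \<comment> \<open>\<open>r\<close> and \<open>R\<close> divide the interval from \<open>r0\<close>
    to \<open>\<rho>\<close> into thirds, so r0 < r < R < \<rho>.\<close>
  define r where "r = (2 * r0 + \<rho>) / 3"
  define R where "R = (r0 + 2 * \<rho>) / 3"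
  have r0: "0 \<le> r0" "r0 < \<rho>" "norm (z - z0) \<le> r0" "norm (w - w0) \<le> r0"
    using z w by (auto simp: r0_def le_max_iff_disj)
  have rR: "0 < r" "r < R" "0 < R" "R < \<rho>" "norm (z - z0) < r" "norm (w - w0) < r"
    using r0 by (auto simp: r_def R_def)
  obtain K where K: "K > 0" "\<And>m. real m * r ^ (m - 1) \<le> K * R ^ m" "\<And>m. r ^ m \<le> R ^ m"
    using mult_power_le_geometric rR(1,2) by blast
  define M where "M = (\<lambda>(m, n). norm (c m n) * R ^ m * R ^ n)"
  have "((\<lambda>(m, n). c m n * of_real R ^ m * of_real R ^ n) has_sum F (z0 + of_real R, w0 + of_real R)) UNIV"
    using F[of "z0 + of_real R" "w0 + of_real R"] rR by simp
  then have "(\<lambda>(m, n). c m n * of_real R ^ m * of_real R ^ n) summable_on UNIV"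
    by (rule has_sum_imp_summable)
  then have "(\<lambda>p. norm (case p of (m, n) \<Rightarrow> c m n * of_real R ^ m * of_real R ^ n)) summable_on UNIV"
    using summable_on_iff_abs_summable_on_complex by blast
  then have M: "M summable_on UNIV"
    using rR by (simp add: M_def case_prod_beta' norm_mult norm_power)
  \<comment> \<open>The double series is enumerated along \<open>prod_decode\<close>, because the
    theorem on differentiating series expects a sequence of terms.\<close>
  then have "(M \<circ> prod_decode) summable_on UNIV"
    by (subst summable_on_reindex_bij_betw[OF bij_prod_decode, unfolded o_def[symmetric]])
  then have Md: "summable (\<lambda>i. M (prod_decode i))"
    by (intro summable_on_imp_summable) (simp add: o_def)
  define f where "f i p = (case prod_decode i of (m, n) \<Rightarrow> c m n * (fst p - z0) ^ m * (snd p - w0) ^ n)" for i and p :: "complex \<times> complex"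
  define d1 where "d1 i p = (case prod_decode i of (m, n) \<Rightarrow> c m n * (of_nat m * (fst p - z0) ^ (m - 1)) * (snd p - w0) ^ n)" for i and p :: "complex \<times> complex"
  define d2 where "d2 i p = (case prod_decode i of (m, n) \<Rightarrow> c m n * (fst p - z0) ^ m * (of_nat n * (snd p - w0) ^ (n - 1)))" for i and p :: "complex \<times> complex"
  define S where "S = ball z0 r \<times> ball w0 r"
  have S: "convex S" "open S" "(z, w) \<in> S"
    using rR by (auto simp: S_def convex_Times open_Times dist_norm norm_minus_commute)
  have b1: "norm (d1 i p) \<le> K * M (prod_decode i)" and b2: "norm (d2 i p) \<le> K * M (prod_decode i)"
    if "p \<in> S" for i p
  proof -
    obtain m n where mn: "prod_decode i = (m, n)" by fastforce
    have p: "norm (fst p - z0) \<le> r" "norm (snd p - w0) \<le> r"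
      using that by (auto simp: S_def dist_norm norm_minus_commute)
    have pw: "norm (fst p - z0) ^ j \<le> R ^ j" "norm (snd p - w0) ^ j \<le> R ^ j" for j
      using power_mono[OF p(1), of j] power_mono[OF p(2), of j] K(3)[of j] by auto
    have pd: "real j * norm (fst p - z0) ^ (j - 1) \<le> K * R ^ j" "real j * norm (snd p - w0) ^ (j - 1) \<le> K * R ^ j" for j
      using mult_left_mono[OF power_mono[OF p(1), of "j - 1"], of "real j"]
        mult_left_mono[OF power_mono[OF p(2), of "j - 1"], of "real j"] K(2)[of j] by auto
    have "norm (d1 i p) = norm (c m n) * ((real m * norm (fst p - z0) ^ (m - 1)) * norm (snd p - w0) ^ n)"
      by (simp add: d1_def mn norm_mult norm_power)
    also have "\<dots> \<le> norm (c m n) * ((K * R ^ m) * R ^ n)"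
      using K(1) rR by (intro mult_left_mono[OF mult_mono[OF pd(1) pw(2)]]) auto
    finally show "norm (d1 i p) \<le> K * M (prod_decode i)" by (simp add: M_def mn mult_ac)
    have "norm (d2 i p) = norm (c m n) * (norm (fst p - z0) ^ m * (real n * norm (snd p - w0) ^ (n - 1)))"
      by (simp add: d2_def mn norm_mult norm_power)
    also have "\<dots> \<le> norm (c m n) * (R ^ m * (K * R ^ n))"
      using K(1) rR by (intro mult_left_mono[OF mult_mono[OF pw(1) pd(2)]]) auto
    finally show "norm (d2 i p) \<le> K * M (prod_decode i)" by (simp add: M_def mn mult_ac)
  qed
  have KM: "summable (\<lambda>i. K * M (prod_decode i))" using Md by (rule summable_mult)
  have s1: "summable (\<lambda>i. norm (d1 i p))" and s2: "summable (\<lambda>i. norm (d2 i p))" if "p \<in> S" for p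
    using b1[OF that] b2[OF that] by (auto intro!: summable_comparison_test'[OF KM, of 0])
  have der: "(f i has_derivative (\<lambda>h. d1 i p * fst h + d2 i p * snd h)) (at p)" for i p
  proof -
    obtain m n where mn: "prod_decode i = (m, n)" by fastforce
    have "((\<lambda>p. c m n * (fst p - z0) ^ m * (snd p - w0) ^ n) has_derivative
       (\<lambda>h. c m n * (fst p - z0) ^ m * (of_nat n * (snd h * (snd p - w0) ^ (n - 1)))
          + c m n * (of_nat m * (fst h * (fst p - z0) ^ (m - 1))) * (snd p - w0) ^ n)) (at p)"
      by (auto intro!: derivative_eq_intros)
    moreover have "f i = (\<lambda>p. c m n * (fst p - z0) ^ m * (snd p - w0) ^ n)"
      by (auto simp: f_def mn)
    ultimately show ?thesis
      by (simp only:) (erule has_derivative_eq_rhs, auto simp: d1_def d2_def mn algebra_simps)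
  qed
  have f_sum: "(\<lambda>i. f i p) sums F p" if "p \<in> S" for p
  proof -
    have "norm (fst p - z0) < \<rho>" "norm (snd p - w0) < \<rho>"
      using that rR by (auto simp: S_def dist_norm norm_minus_commute)
    from F[OF this] have "((\<lambda>i. f i p) has_sum F p) UNIV"
      using has_sum_reindex_bij_betw[OF bij_prod_decode, of "\<lambda>(m, n). c m n * (fst p - z0) ^ m * (snd p - w0) ^ n" "F p"]
      by (simp add: f_def)
    then show ?thesis by (rule has_sum_imp_sums)
  qed
  have uniform: "\<forall>\<^sub>F n in sequentially. \<forall>p\<in>S. \<forall>h. norm ((\<Sum>i<n. d1 i p * fst h + d2 i p * snd h)
      - ((\<Sum>i. d1 i p) * fst h + (\<Sum>i. d2 i p) * snd h)) \<le> e * norm h" if "e > 0" for e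
  proof -
    have "(\<lambda>n. \<Sum>i. K * M (prod_decode (i + n))) \<longlonglongrightarrow> 0"
      using suminf_exist_split2[OF KM] .
    then have "\<forall>\<^sub>F n in sequentially. (\<Sum>i. K * M (prod_decode (i + n))) < e / 2"
      using that by (intro order_tendstoD) auto
    then show ?thesis
    proof eventually_elim
      case (elim n)
      show ?case
      proof (intro ballI allI)
        fix p h assume p: "p \<in> S"
        have t: "norm ((\<Sum>i<n. d i) - (\<Sum>i. d i)) \<le> e / 2"
          if "summable (\<lambda>i. norm (d i))" "\<And>i. norm (d i) \<le> K * M (prod_decode i)" for d :: "nat \<Rightarrow> complex"
        proof -
          have "(\<Sum>i. d i) = (\<Sum>i. d (i + n)) + (\<Sum>i<n. d i)"
            by (rule suminf_split_initial_segment) (rule summable_norm_cancel[OF that(1)])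
          then have "norm ((\<Sum>i<n. d i) - (\<Sum>i. d i)) = norm (\<Sum>i. d (i + n))"
            by (simp add: norm_minus_commute)
          also have "\<dots> \<le> (\<Sum>i. norm (d (i + n)))"
            by (intro summable_norm summable_ignore_initial_segment[OF that(1)])
          also have "\<dots> \<le> (\<Sum>i. K * M (prod_decode (i + n)))"
            by (intro suminf_le that(2) summable_ignore_initial_segment[OF that(1)]
                summable_ignore_initial_segment[OF KM])
          finally show ?thesis using elim by simp
        qed
        have "norm ((\<Sum>i<n. d1 i p * fst h + d2 i p * snd h) - ((\<Sum>i. d1 i p) * fst h + (\<Sum>i. d2 i p) * snd h))
          = norm (((\<Sum>i<n. d1 i p) - (\<Sum>i. d1 i p)) * fst h + ((\<Sum>i<n. d2 i p) - (\<Sum>i. d2 i p)) * snd h)"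
          by (simp add: sum.distrib sum_distrib_left algebra_simps)
        also have "\<dots> \<le> e / 2 * norm (fst h) + e / 2 * norm (snd h)"
          by (rule order_trans[OF norm_triangle_ineq])
            (unfold norm_mult, intro add_mono mult_right_mono t s1 s2 b1 b2 p norm_ge_zero)
        also have "\<dots> \<le> e / 2 * norm h + e / 2 * norm h"
          using that norm_fst_le[of "fst h" "snd h"] norm_snd_le[where x = "fst h" and y = "snd h"]
          by (intro add_mono mult_left_mono) auto
        finally show "norm ((\<Sum>i<n. d1 i p * fst h + d2 i p * snd h)
            - ((\<Sum>i. d1 i p) * fst h + (\<Sum>i. d2 i p) * snd h)) \<le> e * norm h" by simp
      qed
    qed
  qed
  have "\<exists>g. \<forall>p\<in>S. (\<lambda>i. f i p) sums g p \<and>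
      (g has_derivative (\<lambda>h. (\<Sum>i. d1 i p) * fst h + (\<Sum>i. d2 i p) * snd h)) (at p within S)"
  proof (rule has_derivative_series[where f = f and f' = "\<lambda>i p h. d1 i p * fst h + d2 i p * snd h" and x = "(z, w)" and l = "F (z, w)"])
    show "(f i has_derivative (\<lambda>h. d1 i p * fst h + d2 i p * snd h)) (at p within S)" for i p
      using der by (rule has_derivative_at_withinI)
  qed (fact S(1) S(3) f_sum[OF S(3)] uniform)+
  then obtain g where g: "\<And>p. p \<in> S \<Longrightarrow> (\<lambda>i. f i p) sums g p"
      "\<And>p. p \<in> S \<Longrightarrow> (g has_derivative (\<lambda>h. (\<Sum>i. d1 i p) * fst h + (\<Sum>i. d2 i p) * snd h)) (at p within S)"
    by blast
  have "g p = F p" if "p \<in> S" for p using g(1)[OF that] f_sum[OF that] sums_unique2 by blast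
  then have D: "(F has_derivative (\<lambda>h. (\<Sum>i. d1 i (z, w)) * fst h + (\<Sum>i. d2 i (z, w)) * snd h)) (at (z, w))"
    using has_derivative_transform_within_open[OF g(2)[OF S(3), unfolded at_within_open[OF S(3,2)]] S(2,3)] by simp
  have h1: "((\<lambda>i. d1 i (z, w)) has_sum (\<Sum>i. d1 i (z, w))) UNIV"
    and h2: "((\<lambda>i. d2 i (z, w)) has_sum (\<Sum>i. d2 i (z, w))) UNIV"
    using s1[OF S(3)] s2[OF S(3)] by (auto intro!: norm_summable_imp_has_sum summable_sums summable_norm_cancel)
  have H1: "((\<lambda>(m, n). c m n * (of_nat m * (z - z0) ^ (m - 1)) * (w - w0) ^ n) has_sum (\<Sum>i. d1 i (z, w))) UNIV"
    using h1 has_sum_reindex_bij_betw[OF bij_prod_decode, of "\<lambda>(m, n). c m n * (of_nat m * (z - z0) ^ (m - 1)) * (w - w0) ^ n"]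
    by (simp add: d1_def)
  have H2: "((\<lambda>(m, n). c m n * (z - z0) ^ m * (of_nat n * (w - w0) ^ (n - 1))) has_sum (\<Sum>i. d2 i (z, w))) UNIV"
    using h2 has_sum_reindex_bij_betw[OF bij_prod_decode, of "\<lambda>(m, n). c m n * (z - z0) ^ m * (of_nat n * (w - w0) ^ (n - 1))"]
    by (simp add: d2_def)
  show ?thesis
  proof (rule that[OF _ _ D])
    \<comment> \<open>The terms with m = 0 carry the factor 0, so the sum can be restricted to
      successors and reindexed.\<close>
    have "((\<lambda>(m, n). c m n * (of_nat m * (z - z0) ^ (m - 1)) * (w - w0) ^ n) has_sum (\<Sum>i. d1 i (z, w)))
        ((\<lambda>(m, n). (Suc m, n)) ` UNIV)"
    proof (rule has_sum_cong_neutral[THEN iffD1, OF _ _ _ H1])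
      fix p :: "nat \<times> nat" assume "p \<in> UNIV - (\<lambda>(m, n). (Suc m, n)) ` UNIV"
      then have "fst p = 0" by (cases p; cases "fst p") (auto simp: image_iff split: prod.splits)
      then show "(case p of (m, n) \<Rightarrow> c m n * (of_nat m * (z - z0) ^ (m - 1)) * (w - w0) ^ n) = 0"
        by (auto split: prod.splits)
    qed auto
    then show "((\<lambda>(m, n). of_nat (Suc m) * c (Suc m) n * (z - z0) ^ m * (w - w0) ^ n) has_sum (\<Sum>i. d1 i (z, w))) UNIV"
      by (subst (asm) has_sum_reindex) (auto simp: inj_on_def o_def case_prod_beta' mult_ac)
    have "((\<lambda>(m, n). c m n * (z - z0) ^ m * (of_nat n * (w - w0) ^ (n - 1))) has_sum (\<Sum>i. d2 i (z, w)))
        ((\<lambda>(m, n). (m, Suc n)) ` UNIV)"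
    proof (rule has_sum_cong_neutral[THEN iffD1, OF _ _ _ H2])
      fix p :: "nat \<times> nat" assume "p \<in> UNIV - (\<lambda>(m, n). (m, Suc n)) ` UNIV"
      then have "snd p = 0" by (cases p; cases "snd p") (auto simp: image_iff split: prod.splits)
      then show "(case p of (m, n) \<Rightarrow> c m n * (z - z0) ^ m * (of_nat n * (w - w0) ^ (n - 1))) = 0"
        by (auto split: prod.splits)
    qed auto
    then show "((\<lambda>(m, n). of_nat (Suc n) * c m (Suc n) * (z - z0) ^ m * (w - w0) ^ n) has_sum (\<Sum>i. d2 i (z, w))) UNIV"
      by (subst (asm) has_sum_reindex) (auto simp: inj_on_def o_def case_prod_beta' mult_ac)
  qed
qed

text \<open>The inner part of \<open>analytic2_on\<close> with explicit coefficients and radius, so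
  that both can be followed under differentiation.\<close>

definition power_series2_at ::
    "(complex \<times> complex \<Rightarrow> complex) \<Rightarrow> (nat \<Rightarrow> nat \<Rightarrow> complex) \<Rightarrow> complex \<Rightarrow> complex \<Rightarrow> real \<Rightarrow> bool" where
  "power_series2_at F c z0 w0 \<rho> \<longleftrightarrow> (\<forall>z w. norm (z - z0) < \<rho> \<and> norm (w - w0) < \<rho> \<longrightarrow>
     ((\<lambda>(m, n). c m n * (z - z0) ^ m * (w - w0) ^ n) has_sum F (z, w)) UNIV)"

lemma power_series2_at_center:
  assumes "power_series2_at F c z0 w0 \<rho>" "\<rho> > 0"
  shows "((\<lambda>(m, n). c m n * (z0 - z0) ^ m * (w0 - w0) ^ n) has_sum F (z0, w0)) UNIV"
  using assms(1)[unfolded power_series2_at_def, rule_format, of z0 w0] assms(2) by simp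

text \<open>The radius does not shrink, so the result can be applied to the partial derivatives
  again. The derivative of \<open>F\<close> is complex linear, which makes compositions with
  holomorphic curves holomorphic.\<close>

lemma power_series2_at_partial_deriv:
  assumes F: "power_series2_at F c z0 w0 \<rho>"
  shows "power_series2_at (partial_deriv (1, 0) F) (\<lambda>m n. of_nat (Suc m) * c (Suc m) n) z0 w0 \<rho>"
    and "power_series2_at (partial_deriv (0, 1) F) (\<lambda>m n. of_nat (Suc n) * c m (Suc n)) z0 w0 \<rho>"
    and "norm (z - z0) < \<rho> \<Longrightarrow> norm (w - w0) < \<rho> \<Longrightarrow> (F has_derivative
      (\<lambda>h. partial_deriv (1, 0) F (z, w) * fst h + partial_deriv (0, 1) F (z, w) * snd h)) (at (z, w))"
proof -
  have *: "((\<lambda>(m, n). of_nat (Suc m) * c (Suc m) n * (z - z0) ^ m * (w - w0) ^ n) has_sum partial_deriv (1, 0) F (z, w)) UNIV \<and>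
    ((\<lambda>(m, n). of_nat (Suc n) * c m (Suc n) * (z - z0) ^ m * (w - w0) ^ n) has_sum partial_deriv (0, 1) F (z, w)) UNIV \<and>
    (F has_derivative (\<lambda>h. partial_deriv (1, 0) F (z, w) * fst h + partial_deriv (0, 1) F (z, w) * snd h)) (at (z, w))"
    if zw: "norm (z - z0) < \<rho>" "norm (w - w0) < \<rho>" for z w
  proof -
    obtain S1 S2 where S:
      "((\<lambda>(m, n). of_nat (Suc m) * c (Suc m) n * (z - z0) ^ m * (w - w0) ^ n) has_sum S1) UNIV"
      "((\<lambda>(m, n). of_nat (Suc n) * c m (Suc n) * (z - z0) ^ m * (w - w0) ^ n) has_sum S2) UNIV"
      "(F has_derivative (\<lambda>h. S1 * fst h + S2 * snd h)) (at (z, w))"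
    proof (rule power_series2_has_derivative[of z0 \<rho> w0 c F z w])
      show "((\<lambda>(m, n). c m n * (z - z0) ^ m * (w - w0) ^ n) has_sum F (z, w)) UNIV"
        if "norm (z - z0) < \<rho>" "norm (w - w0) < \<rho>" for z w
        using F that unfolding power_series2_at_def by blast
    qed (use zw in auto)
    then have "S1 = partial_deriv (1, 0) F (z, w)" "S2 = partial_deriv (0, 1) F (z, w)"
      using partial_deriv_eqI[OF S(3)] by auto
    then show ?thesis using S by simp
  qed
  then show "power_series2_at (partial_deriv (1, 0) F) (\<lambda>m n. of_nat (Suc m) * c (Suc m) n) z0 w0 \<rho>"
    and "power_series2_at (partial_deriv (0, 1) F) (\<lambda>m n. of_nat (Suc n) * c m (Suc n)) z0 w0 \<rho>"
    and "norm (z - z0) < \<rho> \<Longrightarrow> norm (w - w0) < \<rho> \<Longrightarrow> (F has_derivative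
      (\<lambda>h. partial_deriv (1, 0) F (z, w) * fst h + partial_deriv (0, 1) F (z, w) * snd h)) (at (z, w))"
    unfolding power_series2_at_def by blast+
qed

lemma analytic2_on_iff_power_series2_at:
  "analytic2_on F U \<longleftrightarrow> (\<forall>(z0, w0)\<in>U. \<exists>c. \<exists>\<rho>>0. power_series2_at F c z0 w0 \<rho>)"
  unfolding analytic2_on_def power_series2_at_def ..

text \<open>For the mixed derivatives it is enough to compare the two expansions at their centre:
  both have the coefficients (m + 1) (n + 1) c (m + 1) (n + 1), and every point of \<open>U\<close>
  is a centre.\<close>

lemma analytic2_on_partial_deriv:
  assumes "analytic2_on F U"
  shows "analytic2_on (partial_deriv (1, 0) F) U" and "analytic2_on (partial_deriv (0, 1) F) U"
    and "p \<in> U \<Longrightarrow> (F has_derivative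
      (\<lambda>h. partial_deriv (1, 0) F p * fst h + partial_deriv (0, 1) F p * snd h)) (at p)"
    and "p \<in> U \<Longrightarrow> partial_deriv (0, 1) (partial_deriv (1, 0) F) p = partial_deriv (1, 0) (partial_deriv (0, 1) F) p"
proof -
  have F: "\<exists>c. \<exists>\<rho>>0. power_series2_at F c z0 w0 \<rho>" if "(z0, w0) \<in> U" for z0 w0
    using assms that unfolding analytic2_on_iff_power_series2_at by blast
  show "analytic2_on (partial_deriv (1, 0) F) U" "analytic2_on (partial_deriv (0, 1) F) U"
    unfolding analytic2_on_iff_power_series2_at
    using F power_series2_at_partial_deriv(1,2) by blast+
  show "(F has_derivative (\<lambda>h. partial_deriv (1, 0) F p * fst h + partial_deriv (0, 1) F p * snd h)) (at p)"
    if pU: "p \<in> U"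
  proof -
    obtain z0 w0 where p: "p = (z0, w0)" by fastforce
    obtain c \<rho> where "\<rho> > 0" "power_series2_at F c z0 w0 \<rho>" using F pU p by blast
    then show ?thesis using power_series2_at_partial_deriv(3)[of F c z0 w0 \<rho> z0 w0] p by simp
  qed
  show "partial_deriv (0, 1) (partial_deriv (1, 0) F) p = partial_deriv (1, 0) (partial_deriv (0, 1) F) p"
    if pU: "p \<in> U"
  proof -
    obtain z0 w0 where p: "p = (z0, w0)" by fastforce
    obtain c \<rho> where c: "\<rho> > 0" "power_series2_at F c z0 w0 \<rho>" using F pU p by blast
    note P = power_series2_at_partial_deriv(1,2)[OF c(2)]
    have "(\<lambda>(m, n). of_nat (Suc m) * (of_nat (Suc n) * c (Suc m) (Suc n)) * (z0 - z0) ^ m * (w0 - w0) ^ n)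
        = (\<lambda>(m, n). of_nat (Suc n) * (of_nat (Suc m) * c (Suc m) (Suc n)) * (z0 - z0) ^ m * (w0 - w0) ^ n)"
      by (auto simp: fun_eq_iff algebra_simps)
    then show ?thesis
      using power_series2_at_center[OF power_series2_at_partial_deriv(2)[OF P(1)] c(1)]
        power_series2_at_center[OF power_series2_at_partial_deriv(1)[OF P(2)] c(1)]
      unfolding p by (metis (no_types, lifting) has_sum_unique)
  qed
qed

text \<open>The real points of \<open>U\<close> form an open set of the plane, so agreement of the
  functions there passes to the derivatives. As \<open>u\<close> is arbitrary, the lemma applies in
  turn to partial derivatives and reaches second order.\<close>

lemma partial_deriv_real_restriction:
  assumes F: "analytic2_on F U" and U: "open U"
    and agree: "\<And>x y. (of_real x, of_real y) \<in> U \<Longrightarrow> F (of_real x, of_real y) = u (x, y)"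
    and xy: "(of_real x, of_real y) \<in> U"
  shows "partial_deriv (1, 0) F (of_real x, of_real y) = partial_deriv (1, 0) u (x, y)"
    and "partial_deriv (0, 1) F (of_real x, of_real y) = partial_deriv (0, 1) u (x, y)"
proof -
  define J :: "real \<times> real \<Rightarrow> complex \<times> complex" where "J p = (of_real (fst p), of_real (snd p))" for p
  have J: "(J has_derivative J) (at p)" for p
    unfolding J_def by (auto intro!: derivative_eq_intros)
  have "continuous_on UNIV J" unfolding J_def by (intro continuous_intros)
  then have op: "open (J -` U)" using U by (simp add: continuous_on_open_vimage)
  have "J (x, y) \<in> U" using xy by (simp add: J_def)
  from has_derivative_compose[OF J analytic2_on_partial_deriv(3)[OF F this]]
  have "((\<lambda>p. F (J p)) has_derivative (\<lambda>h. partial_deriv (1, 0) F (J (x, y)) * fst (J h)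
      + partial_deriv (0, 1) F (J (x, y)) * snd (J h))) (at (x, y))" .
  then have "(u has_derivative (\<lambda>h. partial_deriv (1, 0) F (J (x, y)) * fst (J h)
      + partial_deriv (0, 1) F (J (x, y)) * snd (J h))) (at (x, y))"
    by (rule has_derivative_transform_within_open[OF _ op])
      (use xy agree in \<open>auto simp: J_def\<close>)
  from partial_deriv_eqI[OF this]
  show "partial_deriv (1, 0) F (of_real x, of_real y) = partial_deriv (1, 0) u (x, y)"
    "partial_deriv (0, 1) F (of_real x, of_real y) = partial_deriv (0, 1) u (x, y)"
    by (simp_all add: J_def)
qed

section \<open>Restriction to the complexified ellipse\<close>

lemma analytic2_on_compose_cellipse:
  assumes G: "analytic2_on G U" and t: "cellipse a b t \<in> U"
  shows "((\<lambda>t. G (cellipse a b t)) has_field_derivative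
    partial_deriv (1, 0) G (cellipse a b t) * (- of_real a * sin t)
    + partial_deriv (0, 1) G (cellipse a b t) * (of_real b * cos t)) (at t)"
proof -
  have "((\<lambda>t. of_real a * cos t) has_derivative (*) (- of_real a * sin t)) (at t)"
    "((\<lambda>t. of_real b * sin t) has_derivative (*) (of_real b * cos t)) (at t)"
    unfolding has_field_derivative_def[symmetric] by (auto intro!: derivative_eq_intros)
  then have "(cellipse a b has_derivative (\<lambda>h. (- of_real a * sin t * h, of_real b * cos t * h))) (at t)"
    unfolding cellipse_def by (rule has_derivative_Pair)
  from has_derivative_compose[OF this analytic2_on_partial_deriv(3)[OF G t]]
  show ?thesis
    unfolding has_field_derivative_def by (rule has_derivative_eq_rhs) (auto simp: algebra_simps)
qed

lemma analytic2_on_compose_cellipse_holomorphic: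
  assumes "analytic2_on G U" "open V" "cellipse a b ` V \<subseteq> U"
  shows "(\<lambda>t. G (cellipse a b t)) holomorphic_on V"
  using analytic2_on_compose_cellipse[OF assms(1)] assms(2,3)
  by (force simp: holomorphic_on_open)

lemma cellipse_of_real: "cellipse a b (of_real t) = (of_real (a * cos t), of_real (b * sin t))"
  by (simp add: cellipse_def cos_of_real sin_of_real)

definition cdz :: "(complex \<times> complex \<Rightarrow> complex) \<Rightarrow> complex \<times> complex \<Rightarrow> complex" where
  "cdz F p = (partial_deriv (1, 0) F p - \<i> * partial_deriv (0, 1) F p) / 2"

text \<open>The Helmholtz equation is continued along the curve only: \<Delta>F + k^2 F at
  \<open>cellipse a b t\<close> is holomorphic in \<open>t\<close> and vanishes on a real segment,
  hence on the connected set \<open>V\<close>. The identity theorem in one variable suffices,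
  whatever the shape of \<open>U\<close>.\<close>

lemma extension_along_ellipse:
  assumes inc: "incident_wave k u" and ext: "analytic_extension u U F"
    and V: "open V" "connected V" "cellipse a b ` V \<subseteq> U" and r: "r > 0" "of_real ` {-r..r} \<subseteq> V"
  shows "(\<lambda>t. F (cellipse a b t)) holomorphic_on V"
    and "(\<lambda>t. cdz F (cellipse a b t)) holomorphic_on V"
    and "of_real t \<in> V \<Longrightarrow> F (cellipse a b (of_real t)) = u (ellipse a b t)"
    and "of_real t \<in> V \<Longrightarrow> cdz F (cellipse a b (of_real t)) = dz u (ellipse a b t)"
    and "s \<in> V \<Longrightarrow> zpos' a b s = 0 \<Longrightarrow>
      deriv (\<lambda>t. cdz F (cellipse a b t)) s = - (of_real k)\<^sup>2 / 4 * F (cellipse a b s) * zneg' a b s"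
proof -
  have U: "open U" and F: "analytic2_on F U"
    and agree: "(of_real x, of_real y) \<in> U \<Longrightarrow> F (of_real x, of_real y) = u (x, y)" for x y
    using ext by (auto simp: analytic_extension_def)
  let ?F1 = "partial_deriv (1, 0) F" and ?F2 = "partial_deriv (0, 1) F"
  let ?F11 = "partial_deriv (1, 0) ?F1" and ?F22 = "partial_deriv (0, 1) ?F2"
  note F' = analytic2_on_partial_deriv(1,2)[OF F]
  note F'' = analytic2_on_partial_deriv(1)[OF F'(1)] analytic2_on_partial_deriv(2)[OF F'(2)]
  note hol = analytic2_on_compose_cellipse_holomorphic[OF _ V(1,3)]
  note real1 = partial_deriv_real_restriction[where u = u, OF F U]
  show "(\<lambda>t. F (cellipse a b t)) holomorphic_on V" by (rule hol[OF F])
  show "(\<lambda>t. cdz F (cellipse a b t)) holomorphic_on V"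
    unfolding cdz_def by (intro holomorphic_intros hol F') auto
  have in_U: "(of_real (a * cos t), of_real (b * sin t)) \<in> U" if "of_real t \<in> V" for t
    using V(3) that unfolding cellipse_of_real[symmetric] by blast
  show "F (cellipse a b (of_real t)) = u (ellipse a b t)" if "of_real t \<in> V" for t
    using agree[OF in_U[OF that]] by (simp add: cellipse_of_real ellipse_def)
  show "cdz F (cellipse a b (of_real t)) = dz u (ellipse a b t)" if "of_real t \<in> V" for t
    using real1[OF agree in_U[OF that]] by (simp add: cellipse_of_real ellipse_def cdz_def dz_def)
  let ?G = "\<lambda>t. ?F11 (cellipse a b t) + ?F22 (cellipse a b t) + (of_real k)\<^sup>2 * F (cellipse a b t)"
  have G0: "?G s = 0" if "s \<in> V" for s
  proof (rule analytic_continuation[where f = ?G and S = V and U = "of_real ` {-r..r}" and \<xi> = 0])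
    show "?G holomorphic_on V"
      by (intro holomorphic_intros hol F F'')
    show "0 \<in> V" using r by (auto intro!: subsetD[OF r(2)] image_eqI[of _ _ 0])
    show "(0 :: complex) islimpt of_real ` {-r..r}"
      unfolding islimpt_approachable
    proof (intro allI impI)
      fix e :: real assume "e > 0"
      then show "\<exists>x'\<in>of_real ` {-r..r}. x' \<noteq> 0 \<and> dist x' (0 :: complex) < e"
        using r(1) by (intro bexI[of _ "of_real (min r (e / 2))"]) (auto simp: min_def)
    qed
    show "?G z = 0" if z: "z \<in> of_real ` {-r..r}" for z
    proof -
      obtain t where t: "z = of_real t" "t \<in> {-r..r}" using z by blast
      have "of_real t \<in> V" using t r(2) by blast
      note in_U = in_U[OF this]
      have "laplacian u (a * cos t, b * sin t) + of_real (k\<^sup>2) * u (a * cos t, b * sin t) = 0"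
        using inc unfolding incident_wave_def by blast
      then show ?thesis
        using partial_deriv_real_restriction(1)[OF F'(1) U real1(1)[OF agree] in_U]
          partial_deriv_real_restriction(2)[OF F'(2) U real1(2)[OF agree] in_U] agree[OF in_U]
        by (simp add: t(1) cellipse_of_real laplacian_real_pair)
    qed
  qed (use V that r in auto)
  show "deriv (\<lambda>t. cdz F (cellipse a b t)) s = - (of_real k)\<^sup>2 / 4 * F (cellipse a b s) * zneg' a b s"
    if s: "s \<in> V" "zpos' a b s = 0" for s
  proof -
    have sU: "cellipse a b s \<in> U" using s(1) V(3) by blast
    let ?X = "- of_real a * sin s" and ?Y = "of_real b * cos s"
    \<comment> \<open>Z' = 0 means that the tangent is (X, \<i> X). In this direction the mixed
      derivatives cancel, so that \<partial>_z F has derivative \<Delta>F X / 2, while W' = 2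
      X.\<close>
    have "- ?Y = \<i> * (of_real a * sin s)"
      using arg_cong[OF s(2), of "(*) \<i>"] by (simp add: zpos'_def algebra_simps)
    then have "?Y = - (\<i> * (of_real a * sin s))" by (metis minus_minus)
    then have Y: "?Y = \<i> * ?X" by simp
    have "((\<lambda>t. cdz F (cellipse a b t)) has_field_derivative
      ((?F11 (cellipse a b s) * ?X + partial_deriv (0, 1) ?F1 (cellipse a b s) * ?Y)
        - \<i> * (partial_deriv (1, 0) ?F2 (cellipse a b s) * ?X + ?F22 (cellipse a b s) * ?Y)) / 2) (at s)"
      unfolding cdz_def
      by (intro DERIV_cdivide DERIV_diff DERIV_cmult analytic2_on_compose_cellipse[OF F'(1) sU]
          analytic2_on_compose_cellipse[OF F'(2) sU])
    then have "deriv (\<lambda>t. cdz F (cellipse a b t)) s = (?F11 (cellipse a b s) + ?F22 (cellipse a b s)) * ?X / 2"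
      unfolding Y analytic2_on_partial_deriv(4)[OF F sU] by (simp add: DERIV_imp_deriv algebra_simps)
    moreover have "?F11 (cellipse a b s) + ?F22 (cellipse a b s) = - (of_real k)\<^sup>2 * F (cellipse a b s)"
      using G0[OF s(1)] by (simp add: eq_neg_iff_add_eq_0)
    moreover have "zneg' a b s = 2 * ?X"
      using Y by (simp add: zneg'_def algebra_simps)
    ultimately show ?thesis by simp
  qed
qed

section \<open>Asymptotics at the saddle point\<close>

definition saddle_height :: "real \<Rightarrow> real \<Rightarrow> real" where
  "saddle_height a b = ln (sqrt ((a + b) / (a - b)))"

text \<open>The part of \<open>T0\<close> below the saddle point, with its upper boundary solved for the real part:
  \<open>cos r cosh (h - s) = 1\<close> means \<open>r = \<plusminus> arctan (sinh (h - s))\<close>. In this form convexity is visible.\<close>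

definition saddle_cap :: "real \<Rightarrow> complex set" where
  "saddle_cap h = {z. 0 \<le> Im z \<and> Im z \<le> h \<and> \<bar>Re z\<bar> \<le> arctan (sinh (h - Im z))}"

text \<open>\<open>saddle_height\<close> is the radial elliptic coordinate of the boundary with
  respect to its foci \<plusminus>c, and its exponential is the square root in the definition of
  \<open>T0\<close>.\<close>

lemma saddle_height:
  assumes "a > b" "b > 0"
  defines "c \<equiv> sqrt (a\<^sup>2 - b\<^sup>2)"
  shows "c * cosh (saddle_height a b) = a" "c * sinh (saddle_height a b) = b" "c > 0" "saddle_height a b > 0"
proof -
  have c: "c = sqrt (a + b) * sqrt (a - b)"
    by (simp add: c_def flip: real_sqrt_mult) (simp add: power2_eq_square algebra_simps)
  have e: "exp (saddle_height a b) = sqrt (a + b) / sqrt (a - b)"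
    using assms by (simp add: saddle_height_def real_sqrt_divide)
  then have e': "exp (- saddle_height a b) = sqrt (a - b) / sqrt (a + b)"
    by (simp add: exp_minus)
  have 1: "c * exp (saddle_height a b) = a + b" "c * exp (- saddle_height a b) = a - b"
    unfolding c e e' using assms(1,2) by simp_all
  have "c * cosh (saddle_height a b) = (c * exp (saddle_height a b) + c * exp (- saddle_height a b)) / 2"
    "c * sinh (saddle_height a b) = (c * exp (saddle_height a b) - c * exp (- saddle_height a b)) / 2"
    by (simp_all add: cosh_field_def sinh_field_def algebra_simps)
  then show "c * cosh (saddle_height a b) = a" "c * sinh (saddle_height a b) = b"
    by (simp_all add: 1)
  show "c > 0" unfolding c using assms(1,2) by simp
  show "saddle_height a b > 0" using assms by (simp add: saddle_height_def)
qed

text \<open>\<open>arctan (sinh x)\<close> is the Gudermannian gd x: its cosine is 1 / cosh x and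
  its sine tanh x.\<close>

lemma cos_arctan_sinh: "cos (arctan (sinh x)) = 1 / cosh (x :: real)"
proof -
  have "1 + (sinh x)\<^sup>2 = (cosh x)\<^sup>2" using cosh_square_eq[of x] by simp
  then show ?thesis by (simp add: cos_arctan)
qed

lemma sin_arctan_sinh: "sin (arctan (sinh x)) = sinh x / cosh (x :: real)"
proof -
  have "1 + (sinh x)\<^sup>2 = (cosh x)\<^sup>2" using cosh_square_eq[of x] by simp
  then show ?thesis by (simp add: sin_arctan)
qed

lemma arctan_sinh_has_derivative:
  "((\<lambda>s. arctan (sinh (h - s))) has_real_derivative - (1 / cosh (h - s))) (at s)"
proof -
  have "1 + (sinh (h - s))\<^sup>2 = (cosh (h - s))\<^sup>2" using cosh_square_eq[of "h - s"] by simp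
  then show ?thesis
    by (auto intro!: derivative_eq_intros simp: field_simps power2_eq_square)
qed

text \<open>The half width gd (h - s) is concave in s on \<open>{0..h}\<close>, since gd' = 1 / cosh
  decreases on the positive axis. Convexity passes to a neighbourhood of the cap, where holomorphic
  functions then have primitives.\<close>

lemma convex_saddle_cap: "convex (saddle_cap h)"
proof -
  let ?g = "\<lambda>s. arctan (sinh (h - s))"
  have cvx: "convex_on {0..h} (\<lambda>s. - ?g s)"
  proof (rule f''_ge0_imp_convex)
    show "((\<lambda>s. - ?g s) has_real_derivative 1 / cosh (h - s)) (at s)" for s
      using DERIV_minus[OF arctan_sinh_has_derivative[of h s]] by simp
    show "((\<lambda>s. 1 / cosh (h - s)) has_real_derivative sinh (h - s) / (cosh (h - s))\<^sup>2) (at s)" for s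
      by (auto intro!: derivative_eq_intros simp: power2_eq_square)
  qed auto
  show ?thesis
  proof (rule convexI)
    fix x y :: complex and u v :: real
    assume xy: "x \<in> saddle_cap h" "y \<in> saddle_cap h" and uv: "0 \<le> u" "0 \<le> v" "u + v = 1"
    have I: "Im (u *\<^sub>R x + v *\<^sub>R y) = u * Im x + v * Im y" "Re (u *\<^sub>R x + v *\<^sub>R y) = u * Re x + v * Re y"
      by simp_all
    have "u *\<^sub>R Im x + v *\<^sub>R Im y \<in> {0..h}"
      using xy uv by (intro convexD[OF convex_real_interval(5)]) (auto simp: saddle_cap_def)
    moreover have "\<bar>u * Re x + v * Re y\<bar> \<le> u * ?g (Im x) + v * ?g (Im y)"
    proof -
      have "\<bar>u * Re x + v * Re y\<bar> \<le> u * \<bar>Re x\<bar> + v * \<bar>Re y\<bar>"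
        using uv abs_triangle_ineq[of "u * Re x" "v * Re y"] by (simp add: abs_mult)
      also have "\<dots> \<le> u * ?g (Im x) + v * ?g (Im y)"
        using xy uv by (intro add_mono mult_left_mono) (auto simp: saddle_cap_def)
      finally show ?thesis .
    qed
    moreover have "u * ?g (Im x) + v * ?g (Im y) \<le> ?g (u * Im x + v * Im y)"
    proof -
      have "u = 1 - v" using uv by simp
      show ?thesis
        unfolding \<open>u = 1 - v\<close>
        using convex_onD[OF cvx, of v "Im x" "Im y"] xy uv by (auto simp: saddle_cap_def)
    qed
    ultimately show "u *\<^sub>R x + v *\<^sub>R y \<in> saddle_cap h"
      unfolding saddle_cap_def mem_Collect_eq I by auto
  qed
qed

lemma compact_saddle_cap: "compact (saddle_cap h)"
proof -
  have "closed (saddle_cap h)"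
    unfolding saddle_cap_def
    by (intro closed_Collect_conj closed_Collect_le continuous_intros)
  moreover have "bounded (saddle_cap h)"
  proof (rule boundedI)
    fix z assume "z \<in> saddle_cap h"
    then show "norm z \<le> pi / 2 + h"
      using cmod_le[of z] arctan_bounded[of "sinh (h - Im z)"] by (auto simp: saddle_cap_def)
  qed
  ultimately show ?thesis by (simp add: compact_eq_bounded_closed)
qed

lemma saddle_cap_subset_T0:
  assumes "a > b" "b > 0"
  shows "saddle_cap (saddle_height a b) \<subseteq> T0 a b"
proof
  fix z assume z: "z \<in> saddle_cap (saddle_height a b)"
  define h where "h = saddle_height a b"
  define c where "c = sqrt (a\<^sup>2 - b\<^sup>2)"
  note S = saddle_height[OF assms, folded c_def h_def]
  define x where "x = h - Im z"
  define r where "r = \<bar>Re z\<bar>"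
  have x: "0 \<le> x" "x \<le> h" and r: "0 \<le> r" "r \<le> arctan (sinh x)"
    using z by (auto simp: saddle_cap_def x_def h_def r_def)
  have rpi: "r < pi / 2" using r arctan_ubound[of "sinh x"] by linarith
  have cos_ge: "cos r \<ge> 1 / cosh x"
    using cos_monotone_0_pi_le[of r "arctan (sinh x)"] r arctan_ubound[of "sinh x"] cos_arctan_sinh[of x] by simp
  have sin_le: "sin r \<le> sinh x / cosh x"
    using sin_monotone_2pi_le[of r "arctan (sinh x)"] r arctan_ubound[of "sinh x"] sin_arctan_sinh[of x] by simp
  have cos_pos: "cos r > 0" using cos_ge cosh_real_pos[of x] by (smt (verit) divide_pos_pos)
  have sin_nn: "sin r \<ge> 0" using r rpi by (intro sin_ge_zero) auto
  \<comment> \<open>The bound on |r| in \<open>T0\<close> is the same level curve at s = 0: it reads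
    cos r \<ge> 1 / cosh h, and h - s is at most h.\<close>
  have sqrt_eq: "sqrt (1 - b\<^sup>2 / a\<^sup>2) = 1 / cosh h"
  proof -
    have "sqrt (1 - b\<^sup>2 / a\<^sup>2) = c / a"
      using assms by (simp add: c_def real_sqrt_divide[symmetric] diff_divide_distrib flip: real_sqrt_abs2) 
        (simp add: real_sqrt_divide diff_divide_distrib[symmetric] power2_eq_square diff_divide_eq_iff)
    also have "c / a = 1 / cosh h"
      using S(1,3) cosh_real_pos[of h] assms by (simp add: frac_eq_eq mult.commute)
    finally show ?thesis .
  qed
  have A: "r \<le> arccos (sqrt (1 - b\<^sup>2 / a\<^sup>2))"
  proof -
    have "1 / cosh h \<le> 1 / cosh x"
      using x cosh_real_nonneg_le_iff[of x h] cosh_real_pos[of x] by (simp add: frac_le)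
    then have "1 / cosh h \<le> cos r" using cos_ge by linarith
    then have "arccos (cos r) \<le> arccos (1 / cosh h)"
      using cosh_real_ge_1[of h] by (intro arccos_le_arccos) (auto simp: order_trans[of "-1" 0])
    then show ?thesis using r rpi by (simp add: sqrt_eq arccos_cos)
  qed
  have "exp (- x) \<le> (1 - sin r) / cos r"
  proof -
    \<comment> \<open>In this form the lower bound on cos r and the upper bound on sin r both push
      the quotient up. At r = gd x it equals exp (-x).\<close>
    have "(1 - sin r) / cos r = cos r / (1 + sin r)"
    proof -
      have "(1 - sin r) * (1 + sin r) = cos r * cos r"
        using sin_cos_squared_add[of r] by (simp add: power2_eq_square algebra_simps)
      then show ?thesis using cos_pos sin_nn by (simp add: frac_eq_eq)
    qed
    moreover have "cos r / (1 + sin r) \<ge> (1 / cosh x) / (1 + sinh x / cosh x)"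
      using cos_ge cos_pos sin_le sin_nn cosh_real_pos[of x] by (intro frac_le) auto
    moreover have "(1 / cosh x) / (1 + sinh x / cosh x) = exp (- x)"
    proof -
      have "cosh x * (1 + sinh x / cosh x) = exp x"
        using cosh_real_pos[of x] by (simp add: distrib_left cosh_plus_sinh)
      then show ?thesis by (metis divide_divide_eq_left exp_minus inverse_eq_divide)
    qed
    ultimately show ?thesis by simp
  qed
  then have "exp (Im z) \<le> (1 - sin r) / cos r * exp h"
    by (simp add: x_def exp_diff exp_minus field_simps)
  moreover have "exp h = sqrt ((a + b) / (a - b))"
    using assms by (simp add: h_def saddle_height_def)
  ultimately have B: "Im z \<le> ln ((1 - sin r) / cos r * sqrt ((a + b) / (a - b)))"
    by (metis exp_gt_zero less_le_trans ln_exp ln_mono)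
  have "sin r = \<bar>sin (Re z)\<bar>" "cos r = cos (Re z)"
    using sin_nn by (simp_all add: r_def abs_if split: if_splits)
  then show "z \<in> T0 a b"
    using A B z unfolding T0_def
    by (intro CollectI exI[of _ "Re z"] exI[of _ "Im z"]) (auto simp: r_def saddle_cap_def)
qed

lemma zpos_Complex:
  assumes "a > b" "b > 0"
  defines "c \<equiv> sqrt (a\<^sup>2 - b\<^sup>2)"
  shows "Re (zpos a b (Complex r s)) = c * (cos r * cosh (saddle_height a b - s))"
    and "Im (zpos a b (Complex r s)) = c * (sin r * sinh (saddle_height a b - s))"
proof -
  define h where "h = saddle_height a b"
  note S = saddle_height[OF assms(1,2), folded c_def h_def]
  have "Re (zpos a b (Complex r s)) = a * (cos r * cosh s) - b * (cos r * sinh s)"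
    "Im (zpos a b (Complex r s)) = b * (sin r * cosh s) - a * (sin r * sinh s)"
    by (simp_all add: zpos_def Re_cos Im_cos Re_sin Im_sin cosh_field_def sinh_field_def field_simps)
  moreover have "c * (cos r * cosh (h - s)) = (c * cosh h) * (cos r * cosh s) - (c * sinh h) * (cos r * sinh s)"
    "c * (sin r * sinh (h - s)) = (c * sinh h) * (sin r * cosh s) - (c * cosh h) * (sin r * sinh s)"
    unfolding cosh_diff sinh_diff by (simp_all add: algebra_simps)
  ultimately show "Re (zpos a b (Complex r s)) = c * (cos r * cosh (saddle_height a b - s))"
    "Im (zpos a b (Complex r s)) = c * (sin r * sinh (saddle_height a b - s))"
    by (simp_all add: S(1,2) flip: h_def)
qed

lemma zpos_deriv: "(zpos a b has_field_derivative zpos' a b t) (at t)"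
  unfolding zpos_def[abs_def] zpos'_def by (auto intro!: derivative_eq_intros)

lemma zneg_deriv: "(zneg a b has_field_derivative zneg' a b t) (at t)"
  unfolding zneg_def[abs_def] zneg'_def by (auto intro!: derivative_eq_intros)

lemma zpos_zneg_continuous:
  "continuous_on S (zpos a b)" "continuous_on S (zneg a b)" "continuous_on S (zpos' a b)" "continuous_on S (zneg' a b)"
  unfolding zpos_def[abs_def] zneg_def[abs_def] zpos'_def[abs_def] zneg'_def[abs_def]
  by (intro continuous_intros)+

lemma saddle_point:
  assumes "a > b" "b > 0"
  defines "h \<equiv> saddle_height a b"
  shows "zpos' a b (Complex 0 h) = 0" "zneg' a b (Complex 0 h) \<noteq> 0"
    "cellipse a b (Complex 0 h) = (of_real (a\<^sup>2 / sqrt (a\<^sup>2 - b\<^sup>2)), \<i> * of_real (b\<^sup>2 / sqrt (a\<^sup>2 - b\<^sup>2)))"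
proof -
  define c where "c = sqrt (a\<^sup>2 - b\<^sup>2)"
  note S = saddle_height[OF assms(1,2), folded c_def h_def]
  have ch: "cosh h = a / c" "sinh h = b / c" using S by (simp_all add: field_simps)
  have cs: "cos (Complex 0 h) = of_real (a / c)" "sin (Complex 0 h) = \<i> * of_real (b / c)"
    unfolding ch[symmetric]
    by (simp_all add: complex_eq_iff Re_cos Im_cos Re_sin Im_sin cosh_field_def sinh_field_def)
  show "zpos' a b (Complex 0 h) = 0" by (simp add: zpos'_def cs)
  have "zneg' a b (Complex 0 h) = - (2 * \<i> * of_real (a * (b / c)))"
    by (simp add: zneg'_def cs)
  then show "zneg' a b (Complex 0 h) \<noteq> 0" using assms S(3) by simp
  show "cellipse a b (Complex 0 h) = (of_real (a\<^sup>2 / sqrt (a\<^sup>2 - b\<^sup>2)), \<i> * of_real (b\<^sup>2 / sqrt (a\<^sup>2 - b\<^sup>2)))"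
    unfolding c_def[symmetric] by (simp add: cellipse_def cs power2_eq_square)
qed

section \<open>Estimates for the contour integrals\<close>

lemma compact_continuous_norm_bound:
  assumes "compact K" "continuous_on K g"
  obtains B where "\<And>x. x \<in> K \<Longrightarrow> norm (g x) \<le> B"
  using compact_imp_bounded[OF compact_continuous_image[OF assms(2,1)]] by (force simp: bounded_iff)

lemma norm_has_integral_le:
  fixes f :: "real \<Rightarrow> 'a::real_normed_vector"
  assumes "(f has_integral i) {a..b}" "a \<le> b" "0 \<le> B" "\<And>x. x \<in> {a..b} \<Longrightarrow> norm (f x) \<le> B"
  shows "norm i \<le> B * (b - a)"
  using has_integral_bound_real[OF assms(3) finite.emptyI assms(1)] assms(2,4) by simp

text \<open>Replacing \<open>\<Phi>\<close> by the constant \<open>g\<close> changes the integral by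
  at most half of the norm of the replaced one, because the kernel is positive and there is no
  cancellation. The middle half of the interval has length \<open>d\<close> and gives the kernel
  mass at least \<open>d * l\<close>.\<close>

lemma norm_integral_positive_kernel_ge:
  fixes \<Phi> :: "real \<Rightarrow> complex" and k :: "real \<Rightarrow> real"
  assumes d: "d > 0" and k: "continuous_on {-d..d} k" "\<And>t. k t \<ge> 0" "\<And>t. \<bar>t\<bar> \<le> d / 2 \<Longrightarrow> k t \<ge> l"
    and \<Phi>: "\<And>t. \<bar>t\<bar> \<le> d \<Longrightarrow> norm (\<Phi> t - g) \<le> norm g / 2"
    and I: "((\<lambda>t. of_real (k t) * \<Phi> t) has_integral I) {-d..d}"
  shows "norm I \<ge> norm g / 2 * (d * l)"
proof -
  define m where "m = integral {-d..d} k"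
  have k_int: "k integrable_on {-d..d}" using k(1) by (rule integrable_continuous_real)
  have "((\<lambda>t. complex_of_real (k t) * g) has_integral of_real m * g) {-d..d}"
    unfolding m_def using k_int by (intro has_integral_mult_left has_integral_of_real) auto
  from has_integral_diff[OF I this]
  have diff: "((\<lambda>t. of_real (k t) * (\<Phi> t - g)) has_integral I - of_real m * g) {-d..d}"
    by (simp add: algebra_simps)
  have "norm (I - of_real m * g) \<le> integral {-d..d} (\<lambda>t. k t * (norm g / 2))"
    unfolding integral_unique[OF diff, symmetric]
  proof (rule Henstock_Kurzweil_Integration.integral_norm_bound_integral)
    show "(\<lambda>t. of_real (k t) * (\<Phi> t - g)) integrable_on {-d..d}" using diff by blast
    show "(\<lambda>t. k t * (norm g / 2)) integrable_on {-d..d}"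
      using k(1) by (intro integrable_continuous_real continuous_intros)
    show "norm (of_real (k t) * (\<Phi> t - g)) \<le> k t * (norm g / 2)" if "t \<in> {-d..d}" for t
      using mult_left_mono[OF \<Phi>[of t] k(2)[of t]] that k(2)[of t] by (simp add: norm_mult abs_le_iff)
  qed
  also have "\<dots> = m * (norm g / 2)" by (simp add: m_def)
  finally have 1: "norm (I - of_real m * g) \<le> m * (norm g / 2)" .
  have "d * l = integral {-(d/2)..d/2} (\<lambda>_. l)" using d by simp
  also have "\<dots> \<le> integral {-(d/2)..d/2} k"
    using k d by (intro integral_le integrable_continuous_real continuous_on_const continuous_on_subset[OF k(1)]) auto
  also have "\<dots> \<le> m"
    unfolding m_def using k d
    by (intro integral_subset_le k_int integrable_continuous_real continuous_on_subset[OF k(1)]) auto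
  finally have 2: "d * l \<le> m" .
  have "0 \<le> m" unfolding m_def using k(2) k_int by (intro Henstock_Kurzweil_Integration.integral_nonneg) auto
  then have "norm (of_real m * g) = m * norm g" by (simp add: norm_mult)
  then have "norm I \<ge> m * (norm g / 2)"
    using 1 norm_triangle_ineq2[of "of_real m * g" "of_real m * g - I"] by (simp add: norm_minus_commute)
  moreover have "norm g / 2 * (d * l) \<le> norm g / 2 * m" using 2 by (intro mult_left_mono) auto
  ultimately show ?thesis by (simp add: mult.commute)
qed

lemma exp_not_dominated:
  fixes d \<kappa> A :: real
  assumes "d > 0" "\<kappa> > 0" and le: "\<And>l. l \<ge> L \<Longrightarrow> \<kappa> * exp (l * d) \<le> A * (1 + l)"
  shows False
proof -
  \<comment> \<open>The quadratic term of the exponential forces \<kappa> d^2 l \<le> 4 |A|, so any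
    l beyond 8 |A| / (\<kappa> d^2) contradicts it.\<close>
  define l where "l = max (max L 1) (8 * \<bar>A\<bar> / (\<kappa> * d\<^sup>2) + 1)"
  have l: "l \<ge> L" "l \<ge> 1" "l > 8 * \<bar>A\<bar> / (\<kappa> * d\<^sup>2)" by (auto simp: l_def)
  have "1 + l * d + (l * d)\<^sup>2 / 2 \<le> exp (l * d)"
    using l assms by (intro exp_lower_Taylor_quadratic) auto
  then have "(l * d)\<^sup>2 / 2 \<le> exp (l * d)" using l assms by (smt (verit) mult_nonneg_nonneg)
  then have "\<kappa> * ((l * d)\<^sup>2 / 2) \<le> \<kappa> * exp (l * d)" using assms by (intro mult_left_mono) auto
  also have "\<dots> \<le> A * (1 + l)" using le l by blast
  also have "\<dots> \<le> \<bar>A\<bar> * (2 * l)" using l by (intro mult_mono) auto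
  finally have "l * (\<kappa> * d\<^sup>2 * l) \<le> l * (4 * \<bar>A\<bar>)" by (simp add: power2_eq_square field_simps)
  then have "\<kappa> * d\<^sup>2 * l \<le> 4 * \<bar>A\<bar>" using l by simp
  moreover have "8 * \<bar>A\<bar> < \<kappa> * d\<^sup>2 * l" using l(3) assms by (simp add: field_simps)
  ultimately show False by linarith
qed

text \<open>The left side is exactly cos d - sin d sinh x. Times c, it is Re Z at horizontal
  distance \<open>d\<close> outside the cap, at depth \<open>x\<close> below the saddle.\<close>

lemma cos_add_arctan_sinh_le:
  assumes "0 \<le> x" "0 \<le> d" "d \<le> pi"
  shows "cos (d + arctan (sinh x)) * cosh x \<le> cos (d :: real)"
proof -
  have "cos (d + arctan (sinh x)) * cosh x = cos d - sin d * sinh x"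
    using cosh_real_pos[of x] by (simp add: cos_add cos_arctan_sinh sin_arctan_sinh field_simps)
  moreover have "0 \<le> sin d * sinh x" using assms by (intro mult_nonneg_nonneg sin_ge_zero) auto
  ultimately show ?thesis by linarith
qed

lemma norm_exp_zpos_zneg_le:
  assumes "Re (zpos a b t) \<le> M" "l \<ge> 0" "\<bar>\<mu>\<bar> \<le> 1" "norm (zneg a b t) \<le> C"
  shows "norm (exp (of_real l * zpos a b t + of_real \<mu> * zneg a b t)) \<le> exp (l * M) * exp C"
proof -
  have "Re (of_real \<mu> * zneg a b t) \<le> \<bar>\<mu>\<bar> * norm (zneg a b t)"
    using complex_Re_le_cmod[of "of_real \<mu> * zneg a b t"] by (simp add: norm_mult)
  also have "\<dots> \<le> 1 * C" using assms by (intro mult_mono) auto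
  finally have "Re (of_real \<mu> * zneg a b t) \<le> C" by simp
  moreover have "Re (of_real l * zpos a b t) \<le> l * M" using assms by (simp add: mult_left_mono)
  ultimately show ?thesis by (simp add: norm_exp_eq_Re flip: exp_add)
qed

text \<open>\<open>f\<close> and \<open>p\<close> stand for the continuations of u and \<partial>_z
  u, which exist only near the cap; \<open>fR\<close> and \<open>pR\<close> are the values on the
  whole real curve. The contour moves only over the base of the cap, widened by \<delta> on both
  sides.\<close>

lemma saddle_amplitude_eq_0:
  fixes f p :: "complex \<Rightarrow> complex" and fR pR :: "real \<Rightarrow> complex"
  assumes ab: "a > b" "b > 0"
  defines "h \<equiv> saddle_height a b"
  assumes V: "open V" "convex V" "saddle_cap h \<subseteq> V" and m: "m > 0"
    and hol: "f holomorphic_on V" "p holomorphic_on V"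
    and contR: "continuous_on UNIV fR" "continuous_on UNIV pR"
    and agree: "\<And>t. of_real t \<in> V \<Longrightarrow> f (of_real t) = fR t" "\<And>t. of_real t \<in> V \<Longrightarrow> p (of_real t) = pR t"
    and bd: "\<And>l. l > 0 \<Longrightarrow>
      ((\<lambda>t. exp (of_real l * zpos a b (of_real t) + of_real (- m / l) * zneg a b (of_real t))
        * (of_real (- m / l) * zneg' a b (of_real t) * fR t + zpos' a b (of_real t) * pR t))
        has_integral 0) {-pi..pi}"
  shows "deriv p (Complex 0 h) + of_real m * f (Complex 0 h) * zneg' a b (Complex 0 h) = 0"
proof (rule ccontr)
  define c where "c = sqrt (a\<^sup>2 - b\<^sup>2)"
  note S = saddle_height[OF ab, folded c_def h_def]
  note Z = zpos_Complex[OF ab, folded c_def h_def]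
  \<comment> \<open>The amplitude left by the integration by parts, without the factor exp (l Z).
    Its last term comes from differentiating exp (\<mu> W) and fades as \<mu> tends to 0.\<close>
  define \<Phi> where "\<Phi> \<mu> t = exp (of_real \<mu> * zneg a b t)
    * (deriv p t + of_real m * f t * zneg' a b t + of_real \<mu> * zneg' a b t * p t)" for \<mu> :: real and t
  define g0 where "g0 = \<Phi> 0 (Complex 0 h)"
  assume "deriv p (Complex 0 h) + of_real m * f (Complex 0 h) * zneg' a b (Complex 0 h) \<noteq> 0"
  then have g0: "norm g0 > 0" by (simp add: g0_def \<Phi>_def)

  obtain \<eta> where \<eta>: "\<eta> > 0" "(\<Union>x\<in>saddle_cap h. cball x \<eta>) \<subseteq> V"
    using compact_subset_open_imp_cball_epsilon_subset[OF compact_saddle_cap V(1,3)] .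
  \<comment> \<open>The closed \<eta>-thickening of the cap: compact, inside \<open>V\<close>, and
    containing every part of the new contour.\<close>
  define K where "K = (\<lambda>(x, y). x + y) ` (saddle_cap h \<times> cball 0 \<eta>)"
  have K: "compact K"
    unfolding K_def
    by (intro compact_continuous_image compact_Times compact_saddle_cap compact_cball)
      (auto intro!: continuous_intros simp: case_prod_beta)
  have KI: "z \<in> K" if "x \<in> saddle_cap h" "dist x z \<le> \<eta>" for x z
    unfolding K_def using that
    by (intro image_eqI[of _ _ "(x, z - x)"]) (auto simp: dist_norm norm_minus_commute)
  have KV: "K \<subseteq> V"
  proof
    fix z assume "z \<in> K"
    then obtain x y where "x \<in> saddle_cap h" "norm y \<le> \<eta>" "z = x + y" by (auto simp: K_def)
    then have "z \<in> cball x \<eta>" by (simp add: dist_norm)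
    then show "z \<in> V" using \<eta>(2) \<open>x \<in> saddle_cap h\<close> by blast
  qed
  have contV: "continuous_on V f" "continuous_on V p" "continuous_on V (deriv p)"
    using hol V(1) by (auto intro: holomorphic_on_imp_continuous_on holomorphic_deriv)

  obtain C where C: "\<And>t. t \<in> K \<Longrightarrow> norm (f t) \<le> C" "\<And>t. t \<in> K \<Longrightarrow> norm (p t) \<le> C"
    "\<And>t. t \<in> K \<Longrightarrow> norm (deriv p t) \<le> C" "\<And>t. t \<in> K \<Longrightarrow> norm (zneg a b t) \<le> C" "\<And>t. t \<in> K \<Longrightarrow> norm (zneg' a b t) \<le> C"
    "\<And>t. t \<in> {-pi..pi} \<Longrightarrow> norm (fR t) \<le> C" "\<And>t. t \<in> {-pi..pi} \<Longrightarrow> norm (pR t) \<le> C"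
    "\<And>t. t \<in> {-pi..pi} \<Longrightarrow> norm (zneg a b (of_real t)) \<le> C"
    "\<And>t. t \<in> {-pi..pi} \<Longrightarrow> norm (zneg' a b (of_real t)) \<le> C"
    "\<And>t. t \<in> {-pi..pi} \<Longrightarrow> norm (zpos' a b (of_real t)) \<le> C"
    and C0: "C \<ge> 0"
  proof -
    obtain B1 where B1: "\<And>t. t \<in> K \<Longrightarrow>
        norm (norm (f t) + norm (p t) + norm (deriv p t) + norm (zneg a b t) + norm (zneg' a b t)) \<le> B1"
      by (rule compact_continuous_norm_bound[OF K, of "\<lambda>t. norm (f t) + norm (p t) + norm (deriv p t) + norm (zneg a b t) + norm (zneg' a b t)"])
        (auto intro!: continuous_intros continuous_on_subset[OF contV(1) KV] continuous_on_subset[OF contV(2) KV]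
          continuous_on_subset[OF contV(3) KV] zpos_zneg_continuous)
    obtain B2 where B2: "\<And>t. t \<in> {-pi..pi} \<Longrightarrow>
        norm (norm (fR t) + norm (pR t) + norm (zneg a b (of_real t)) + norm (zneg' a b (of_real t)) + norm (zpos' a b (of_real t))) \<le> B2"
      by (rule compact_continuous_norm_bound[of "{-pi..pi}" "\<lambda>t. norm (fR t) + norm (pR t) + norm (zneg a b (of_real t)) + norm (zneg' a b (of_real t)) + norm (zpos' a b (of_real t))"])
        (auto intro!: continuous_intros continuous_on_subset[OF contR(1)] continuous_on_subset[OF contR(2)]
          continuous_on_compose2[OF zpos_zneg_continuous(2)[of UNIV]] continuous_on_compose2[OF zpos_zneg_continuous(3)[of UNIV]]
          continuous_on_compose2[OF zpos_zneg_continuous(4)[of UNIV]])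
    define B where "B = max 0 (max B1 B2)"
    have B1': "norm (f t) + norm (p t) + norm (deriv p t) + norm (zneg a b t) + norm (zneg' a b t) \<le> B" if "t \<in> K" for t
      using B1[OF that] by (simp add: B_def)
    have B2': "norm (fR t) + norm (pR t) + norm (zneg a b (of_real t)) + norm (zneg' a b (of_real t)) + norm (zpos' a b (of_real t)) \<le> B"
      if "t \<in> {-pi..pi}" for t
      using B2[OF that] by (simp add: B_def)
    show ?thesis
    proof (rule that[of B])
      fix t assume t: "t \<in> K"
      note n = norm_ge_zero[of "f t"] norm_ge_zero[of "p t"] norm_ge_zero[of "deriv p t"]
        norm_ge_zero[of "zneg a b t"] norm_ge_zero[of "zneg' a b t"] B1'[OF t]
      show "norm (f t) \<le> B" using n by linarith
      show "norm (p t) \<le> B" using n by linarith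
      show "norm (deriv p t) \<le> B" using n by linarith
      show "norm (zneg a b t) \<le> B" using n by linarith
      show "norm (zneg' a b t) \<le> B" using n by linarith
    next
      fix t assume t: "t \<in> {-pi..pi}"
      note n = norm_ge_zero[of "fR t"] norm_ge_zero[of "pR t"] norm_ge_zero[of "zneg a b (of_real t)"]
        norm_ge_zero[of "zneg' a b (of_real t)"] norm_ge_zero[of "zpos' a b (of_real t)"] B2'[OF t]
      show "norm (fR t) \<le> B" using n by linarith
      show "norm (pR t) \<le> B" using n by linarith
      show "norm (zneg a b (of_real t)) \<le> B" using n by linarith
      show "norm (zneg' a b (of_real t)) \<le> B" using n by linarith
      show "norm (zpos' a b (of_real t)) \<le> B" using n by linarith
    qed (simp add: B_def)
  qed

  obtain \<epsilon> where \<epsilon>: "\<epsilon> > 0"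
    "\<And>\<mu> t. \<bar>\<mu>\<bar> < \<epsilon> \<Longrightarrow> norm (t - Complex 0 h) < \<epsilon> \<Longrightarrow> norm (\<Phi> \<mu> t - g0) \<le> norm g0 / 2"
  proof -
    have "continuous_on (UNIV \<times> V) (\<lambda>x. \<Phi> (fst x) (snd x))"
      unfolding \<Phi>_def
      by (intro continuous_intros continuous_on_compose2[OF contV(1)] continuous_on_compose2[OF contV(2)]
          continuous_on_compose2[OF contV(3)] continuous_on_compose2[OF zpos_zneg_continuous(2)[of UNIV]]
          continuous_on_compose2[OF zpos_zneg_continuous(4)[of UNIV]]) auto
    moreover have "Complex 0 h \<in> saddle_cap h" using S(4) by (simp add: saddle_cap_def)
    ultimately have "isCont (\<lambda>x. \<Phi> (fst x) (snd x)) (0, Complex 0 h)"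
      using V(1,3) by (subst (asm) continuous_on_eq_continuous_at) (auto simp: open_Times)
    then obtain e where e: "e > 0" "\<And>x. dist x (0, Complex 0 h) < e \<Longrightarrow> dist (\<Phi> (fst x) (snd x)) g0 < norm g0 / 2"
      using g0 unfolding continuous_at_eps_delta g0_def by (metis fst_conv snd_conv half_gt_zero)
    show ?thesis
    proof (rule that[of "e / 2"])
      fix \<mu> :: real and t assume "\<bar>\<mu>\<bar> < e / 2" "norm (t - Complex 0 h) < e / 2"
      then have "dist (\<mu>, t) (0, Complex 0 h) < e"
        using sqrt_sum_squares_le_sum[of "\<bar>\<mu>\<bar>" "norm (t - Complex 0 h)"]
        by (simp add: dist_norm norm_Pair)
      from e(2)[OF this] show "norm (\<Phi> \<mu> t - g0) \<le> norm g0 / 2" by (simp add: dist_norm)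
    qed (use e in simp)
  qed

  \<comment> \<open>\<delta> \<le> \<eta> keeps the contour in \<open>K\<close>, \<delta> <
    \<epsilon> keeps \<Phi> close to \<open>g0\<close> on the horizontal part, and \<delta> \<le> 1
    gives \<delta> \<le> pi / 2, hence r \<le> pi below.\<close>
  define \<delta> where "\<delta> = min (min \<eta> (\<epsilon> / 2)) 1"
  have \<delta>: "\<delta> > 0" "\<delta> \<le> \<eta>" "\<delta> < \<epsilon>" "\<delta> \<le> 1" using \<eta> \<epsilon>(1) by (auto simp: \<delta>_def min_def)
  have \<delta>pi: "\<delta> \<le> pi / 2" using \<delta>(4) pi_ge_two by linarith
  define r where "r = \<delta> + arctan (sinh h)"
  have r: "0 < r" "r \<le> pi"
  proof -
    have "arctan (sinh h) > 0" using S(4) by (simp add: zero_less_arctan_iff)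
    then show "0 < r" unfolding r_def using \<delta>(1) by linarith
    show "r \<le> pi" using \<delta>pi arctan_ubound[of "sinh h"] unfolding r_def by linarith
  qed
  have real_K: "of_real t \<in> K" if "\<bar>t\<bar> \<le> r" for t
  proof -
    obtain y where y: "y = arctan (sinh h)" "y > 0" using S(4) by (simp add: zero_less_arctan_iff)
    \<comment> \<open>The nearest point of the base of the cap.\<close>
    define x where "x = max (- y) (min t y)"
    have "\<bar>x\<bar> \<le> arctan (sinh h)" "\<bar>x - t\<bar> \<le> \<delta>"
      using that \<delta>(1) y(2) unfolding r_def y(1)[symmetric] by (auto simp: x_def)
    then show ?thesis
      using \<delta> S(4) by (intro KI[of "of_real x"]) (auto simp: saddle_cap_def dist_norm simp flip: of_real_diff)
  qed
  have Re_real: "Re (zpos a b (of_real t)) \<le> c * cos \<delta>" if "r \<le> \<bar>t\<bar>" "\<bar>t\<bar> \<le> pi" for t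
  proof -
    have "cos t = cos \<bar>t\<bar>" by (simp add: abs_if)
    also have "\<dots> \<le> cos r" using that r by (intro cos_monotone_0_pi_le) auto
    finally have "cos t * cosh h \<le> cos r * cosh h" using cosh_real_pos[of h] by simp
    also have "\<dots> \<le> cos \<delta>"
      unfolding r_def using S(4) \<delta> \<delta>pi by (intro cos_add_arctan_sinh_le) auto
    finally have "c * (cos t * cosh h) \<le> c * cos \<delta>" using S(3) by simp
    then show ?thesis using Z(1)[of t 0] by (simp add: complex_of_real_def)
  qed

  define M1 where "M1 = exp C * (C + m * C * C + C * C)"
  define M2 where "M2 = exp C * (C * C + C * C)"
  have M: "M1 \<ge> 0" "M2 \<ge> 0" using C0 m by (auto simp: M1_def M2_def)
  define A where "A = 4 * M1 * h + 2 * exp C * C + 2 * pi * M2"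
  have main: "norm g0 / 2 * (\<delta> * exp (l * (c * cos (\<delta> / 2)))) \<le> A * (1 + l) * exp (l * (c * cos \<delta>))"
    if l: "l \<ge> 1 + m + m / \<epsilon> + 1" for l
  proof -
    \<comment> \<open>With this \<mu> the product l \<mu> is the constant - m. The lower bound on
      \<open>l\<close> yields |\<mu>| \<le> 1, for the uniform bounds, and |\<mu>| < \<epsilon>, for
      the estimate at the saddle.\<close>
    define \<mu> where "\<mu> = - m / l"
    have "m / \<epsilon> > 0" using m \<epsilon>(1) by simp
    then have l0: "l > 0" "l \<ge> 1" "l > m" "l > m / \<epsilon>" using l m by linarith+
    have \<mu>: "\<bar>\<mu>\<bar> \<le> 1" "\<bar>\<mu>\<bar> < \<epsilon>"
      using l0 m \<epsilon>(1) by (auto simp: \<mu>_def field_simps)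
    have lm: "of_real l * of_real \<mu> = (- of_real m :: complex)"
      unfolding \<mu>_def of_real_mult[symmetric] using l0(1) by simp
    define E where "E = exp (l * (c * cos \<delta>))"
    have E: "E > 0" by (simp add: E_def)
    define ex where "ex t = exp (of_real l * zpos a b t + of_real \<mu> * zneg a b t)" for t
    have ex_split: "ex t = exp (of_real l * zpos a b t) * exp (of_real \<mu> * zneg a b t)" for t
      by (simp add: ex_def exp_add)
    have ex_deriv: "(ex has_field_derivative ex t * (of_real l * zpos' a b t + of_real \<mu> * zneg' a b t)) (at t)" for t
      unfolding ex_def[abs_def] by (auto intro!: derivative_eq_intros zpos_deriv zneg_deriv)
    have norm_ex: "norm (ex t) \<le> E * exp C" if "Re (zpos a b t) \<le> c * cos \<delta>" "norm (zneg a b t) \<le> C" for t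
      unfolding ex_def E_def using that l0 \<mu> by (intro norm_exp_zpos_zneg_le) auto
    have norm_\<Phi>: "norm (\<Phi> \<mu> t) \<le> M1" if t: "t \<in> K" for t
    proof -
      have "norm (exp (of_real \<mu> * zneg a b t)) \<le> exp C"
        using norm_exp_zpos_zneg_le[of a b t "Re (zpos a b t)" 0 \<mu> C] \<mu> C(4)[OF t] by simp
      moreover have "norm (deriv p t + of_real m * f t * zneg' a b t + of_real \<mu> * zneg' a b t * p t)
          \<le> C + m * C * C + 1 * C * C"
        by (intro norm_triangle_le add_mono C(3)[OF t];
            unfold norm_mult norm_of_real; intro mult_mono mult_nonneg_nonneg)
          (use C(1-5)[OF t] C0 m \<mu> in auto)
      ultimately show ?thesis
        unfolding \<Phi>_def M1_def norm_mult by (intro mult_mono) (auto simp: C0)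
    qed
    have norm_zpos: "norm (exp (of_real l * zpos a b t)) \<le> E" if "Re (zpos a b t) \<le> c * cos \<delta>" for t
      using norm_exp_zpos_zneg_le[OF that, of l 0 "norm (zneg a b t)"] l0 that
      by (simp add: norm_exp_eq_Re E_def)
    have "(\<lambda>t. exp (of_real l * zpos a b t) * \<Phi> \<mu> t) holomorphic_on V"
      unfolding \<Phi>_def zpos_def zneg_def zneg'_def
      by (intro holomorphic_intros hol holomorphic_deriv V(1))
    \<comment> \<open>A primitive on the convex set \<open>V\<close>: moving the contour becomes
      comparing values of \<open>H\<close> at the ends of its pieces.\<close>
    then obtain H where "\<And>t. t \<in> V \<Longrightarrow> (H has_field_derivative exp (of_real l * zpos a b t) * \<Phi> \<mu> t) (at t within V)"
      using holomorphic_convex_primitive'[OF V(2,1)] by blast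
    then have H: "(H has_field_derivative exp (of_real l * zpos a b t) * \<Phi> \<mu> t) (at t)" if "t \<in> V" for t
      using that V(1) by (metis at_within_open)

    \<comment> \<open>The sides of the new contour, from the real axis up to height \<open>h\<close> at distance \<open>\<delta>\<close> from the cap,
      on which \<open>Re Z \<le> c cos \<delta>\<close>.\<close>
    have side: "norm (H (Complex (\<sigma> * \<delta>) h) - H (of_real (\<sigma> * r))) \<le> 2 * M1 * E * h" if \<sigma>: "\<bar>\<sigma>\<bar> = 1" for \<sigma>
    proof -
      define \<gamma> where "\<gamma> s = of_real (\<sigma> * (\<delta> + arctan (sinh (h - s)))) + \<i> * of_real s" for s
      have \<gamma>_deriv: "(\<gamma> has_vector_derivative of_real (\<sigma> * - (1 / cosh (h - s))) + \<i> * of_real 1) (at s)" for s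
      proof -
        have "((\<lambda>s. \<sigma> * (\<delta> + arctan (sinh (h - s)))) has_real_derivative \<sigma> * (0 + - (1 / cosh (h - s)))) (at s)"
          by (intro DERIV_cmult DERIV_add DERIV_const arctan_sinh_has_derivative)
        then have "((\<lambda>s. \<sigma> * (\<delta> + arctan (sinh (h - s)))) has_real_derivative \<sigma> * - (1 / cosh (h - s))) (at s)"
          by (simp only: add_0)
        then show ?thesis
          unfolding \<gamma>_def[abs_def]
          by (intro has_vector_derivative_add has_vector_derivative_mult_right has_vector_derivative_of_real DERIV_ident)
      qed
      have \<gamma>K: "\<gamma> s \<in> K" if s: "s \<in> {0..h}" for s
      proof (rule KI)
        show "of_real (\<sigma> * arctan (sinh (h - s))) + \<i> * of_real s \<in> saddle_cap h"
          using s \<sigma> by (auto simp: saddle_cap_def abs_mult zero_le_arctan_iff)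
        show "dist (of_real (\<sigma> * arctan (sinh (h - s))) + \<i> * of_real s) (\<gamma> s) \<le> \<eta>"
          using \<delta> \<sigma> by (simp add: \<gamma>_def dist_norm algebra_simps norm_mult abs_mult flip: of_real_mult)
      qed
      have Re_\<gamma>: "Re (zpos a b (\<gamma> s)) \<le> c * cos \<delta>" if s: "s \<in> {0..h}" for s
      proof -
        have "\<gamma> s = Complex (\<sigma> * (\<delta> + arctan (sinh (h - s)))) s" by (simp add: \<gamma>_def complex_eq_iff)
        moreover have "cos (\<sigma> * (\<delta> + arctan (sinh (h - s)))) = cos (\<delta> + arctan (sinh (h - s)))"
        proof -
          have "\<sigma> = 1 \<or> \<sigma> = -1" using \<sigma> by linarith
          then show ?thesis by (elim disjE) (simp_all only: mult_1 mult_minus1 cos_minus)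
        qed
        ultimately have "Re (zpos a b (\<gamma> s)) = c * (cos (\<delta> + arctan (sinh (h - s))) * cosh (h - s))"
          by (simp add: Z(1))
        then show ?thesis
          using cos_add_arctan_sinh_le[of "h - s" \<delta>] s \<delta> \<delta>pi S(3) by (auto intro!: mult_left_mono)
      qed
      have "((\<lambda>s. (of_real (\<sigma> * - (1 / cosh (h - s))) + \<i> * of_real 1) * (exp (of_real l * zpos a b (\<gamma> s)) * \<Phi> \<mu> (\<gamma> s)))
          has_integral (H \<circ> \<gamma>) h - (H \<circ> \<gamma>) 0) {0..h}"
        using S(4) KV \<gamma>K
        by (intro fundamental_theorem_of_calculus has_vector_derivative_at_within[OF field_vector_diff_chain_at] \<gamma>_deriv H) auto
      then have "norm ((H \<circ> \<gamma>) h - (H \<circ> \<gamma>) 0) \<le> (2 * (E * M1)) * (h - 0)"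
      proof (rule norm_has_integral_le)
        fix s assume s: "s \<in> {0..h}"
        have "norm (of_real (\<sigma> * - (1 / cosh (h - s))) + \<i> * of_real 1 :: complex) \<le> \<bar>\<sigma>\<bar> * (1 / cosh (h - s)) + 1"
          using cosh_real_pos[of "h - s"] by (intro order_trans[OF norm_triangle_ineq]) (simp add: norm_mult norm_divide)
        also have "\<dots> \<le> 2" using \<sigma> cosh_real_ge_1[of "h - s"] by simp
        finally have "norm (of_real (\<sigma> * - (1 / cosh (h - s))) + \<i> * of_real 1 :: complex) \<le> 2" .
        then show "norm ((of_real (\<sigma> * - (1 / cosh (h - s))) + \<i> * of_real 1) * (exp (of_real l * zpos a b (\<gamma> s)) * \<Phi> \<mu> (\<gamma> s))) \<le> 2 * (E * M1)"
          unfolding norm_mult[of "of_real (\<sigma> * - (1 / cosh (h - s))) + \<i> * of_real 1"] norm_mult[of "exp _"]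
          using norm_zpos[OF Re_\<gamma>[OF s]] norm_\<Phi>[OF \<gamma>K[OF s]] E M by (intro mult_mono) auto
      qed (use E M S(4) in auto)
      moreover have "\<gamma> h = Complex (\<sigma> * \<delta>) h" "\<gamma> 0 = of_real (\<sigma> * r)"
        by (simp_all add: \<gamma>_def r_def complex_eq_iff)
      ultimately show ?thesis using S(4) by (simp add: mult_ac)
    qed

    \<comment> \<open>On the horizontal part \<open>Z\<close> is the real number \<open>c cos \<tau>\<close>, so the kernel is positive and no oscillation
      has to be controlled.\<close>
    have top: "norm g0 / 2 * (\<delta> * exp (l * (c * cos (\<delta> / 2)))) \<le> norm (H (Complex \<delta> h) - H (Complex (- \<delta>) h))"
    proof -
      have in_K: "Complex t h \<in> K" if "t \<in> {-\<delta>..\<delta>}" for t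
        using that \<delta> S(4)
        by (intro KI[of "Complex 0 h"]) (auto simp: saddle_cap_def dist_norm Complex_eq norm_mult simp flip: of_real_diff)
      have zp: "zpos a b (Complex t h) = of_real (c * cos t)" for t
        using Z[of t h] by (simp add: complex_eq_iff)
      have der: "((\<lambda>t. Complex t h) has_vector_derivative 1) (at t)" for t
        unfolding Complex_eq by (auto intro!: derivative_eq_intros)
      have "((\<lambda>t. 1 * (exp (of_real l * zpos a b (Complex t h)) * \<Phi> \<mu> (Complex t h))) has_integral
          (H \<circ> (\<lambda>t. Complex t h)) \<delta> - (H \<circ> (\<lambda>t. Complex t h)) (- \<delta>)) {-\<delta>..\<delta>}"
        using \<delta> KV in_K
        by (intro fundamental_theorem_of_calculus has_vector_derivative_at_within[OF field_vector_diff_chain_at] der H) auto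
      then have I: "((\<lambda>t. of_real (exp (l * (c * cos t))) * \<Phi> \<mu> (Complex t h)) has_integral
          H (Complex \<delta> h) - H (Complex (- \<delta>) h)) {-\<delta>..\<delta>}"
        by (simp add: zp exp_of_real[symmetric])
      show ?thesis
      proof (rule norm_integral_positive_kernel_ge[OF \<delta>(1) _ _ _ _ I])
        show "continuous_on {-\<delta>..\<delta>} (\<lambda>t. exp (l * (c * cos t)))" by (intro continuous_intros)
        show "exp (l * (c * cos (\<delta> / 2))) \<le> exp (l * (c * cos t))" if "\<bar>t\<bar> \<le> \<delta> / 2" for t
        proof -
          have "cos (\<delta> / 2) \<le> cos \<bar>t\<bar>" using that \<delta> \<delta>pi by (intro cos_monotone_0_pi_le) auto
          then show ?thesis using l0 S(3) by (simp add: abs_if split: if_splits)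
        qed
        show "norm (\<Phi> \<mu> (Complex t h) - g0) \<le> norm g0 / 2" if "\<bar>t\<bar> \<le> \<delta>" for t
          using that \<delta> \<mu> by (intro \<epsilon>(2)) (auto simp: cmod_def)
      qed auto
    qed

    \<comment> \<open>\<open>l\<close> times the integrand of the boundary identity is the derivative of \<open>ex p - H\<close>; beyond \<open>\<plusminus>r\<close> it is
      small already on the real axis.\<close>
    have bottom: "norm (H (of_real r) - H (of_real (- r))) \<le> 2 * exp C * C * E + l * (2 * pi * M2 * E)"
    proof -
      define g where "g t = ex (of_real t) * (of_real \<mu> * zneg' a b (of_real t) * fR t + zpos' a b (of_real t) * pR t)" for t
      have g_cont: "continuous_on S g" for S
        unfolding g_def ex_def
        by (intro continuous_intros continuous_on_subset[OF contR(1)] continuous_on_subset[OF contR(2)]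
          continuous_on_compose2[OF zpos_zneg_continuous(1)[of UNIV]] continuous_on_compose2[OF zpos_zneg_continuous(2)[of UNIV]]
          continuous_on_compose2[OF zpos_zneg_continuous(3)[of UNIV]] continuous_on_compose2[OF zpos_zneg_continuous(4)[of UNIV]]) auto
      have gi: "g integrable_on {x..y}" for x y using g_cont by (rule integrable_continuous_real)
      have zero: "integral {-pi..pi} g = 0"
        using bd[OF l0(1)] by (intro integral_unique) (simp add: g_def[abs_def] ex_def \<mu>_def)
      have norm_g: "norm (g t) \<le> M2 * E" if t: "r \<le> \<bar>t\<bar>" "\<bar>t\<bar> \<le> pi" for t
      proof -
        have tp: "t \<in> {-pi..pi}" using t by auto
        have "norm (of_real \<mu> * zneg' a b (of_real t) * fR t + zpos' a b (of_real t) * pR t) \<le> 1 * C * C + C * C"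
          by (intro norm_triangle_le add_mono;
              unfold norm_mult norm_of_real; intro mult_mono mult_nonneg_nonneg)
            (use C(6-10)[OF tp] C0 \<mu> in auto)
        then have "norm (g t) \<le> (E * exp C) * (1 * C * C + C * C)"
          unfolding g_def norm_mult[of "ex _"]
          using norm_ex[OF Re_real[OF t] C(8)[OF tp]] E C0 by (intro mult_mono) auto
        then show ?thesis by (simp add: M2_def mult_ac)
      qed
      have left: "norm (integral {-pi..-r} g) \<le> M2 * E * pi" and right: "norm (integral {r..pi} g) \<le> M2 * E * pi"
      proof -
        have "norm (integral {-pi..-r} g) \<le> M2 * E * (-r - (-pi))"
          using r M E by (intro norm_has_integral_le[OF integrable_integral[OF gi]] norm_g) auto
        also have "\<dots> \<le> M2 * E * pi" using r M E by (intro mult_left_mono) auto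
        finally show "norm (integral {-pi..-r} g) \<le> M2 * E * pi" .
        have "norm (integral {r..pi} g) \<le> M2 * E * (pi - r)"
          using r M E by (intro norm_has_integral_le[OF integrable_integral[OF gi]] norm_g) auto
        also have "\<dots> \<le> M2 * E * pi" using r M E by (intro mult_left_mono) auto
        finally show "norm (integral {r..pi} g) \<le> M2 * E * pi" .
      qed
      \<comment> \<open>The whole integral is 0 by the boundary identity, so the middle part is
        controlled by the two outer parts, which are small.\<close>
      have split: "integral {-pi..-r} g + integral {-r..r} g + integral {r..pi} g = 0"
        using Henstock_Kurzweil_Integration.integral_combine[of "-pi" "-r" r g]
          Henstock_Kurzweil_Integration.integral_combine[of "-pi" r pi g] gi zero r by simp
      have "((\<lambda>t. of_real l * g t) has_integral
          (ex (of_real r) * p (of_real r) - H (of_real r)) - (ex (of_real (- r)) * p (of_real (- r)) - H (of_real (- r)))) {-r..r}"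
      proof (rule fundamental_theorem_of_calculus)
        show "-r \<le> r" using r by simp
        fix t assume t: "t \<in> {-r..r}"
        then have tV: "of_real t \<in> V" using real_K[of t] KV by auto
        have dp: "(p has_field_derivative deriv p (of_real t)) (at (of_real t))"
          using holomorphic_derivI[OF hol(2) V(1) tV] .
        have "((\<lambda>z. ex z * p z - H z) has_field_derivative
            (ex (of_real t) * deriv p (of_real t)
             + ex (of_real t) * (of_real l * zpos' a b (of_real t) + of_real \<mu> * zneg' a b (of_real t)) * p (of_real t))
            - exp (of_real l * zpos a b (of_real t)) * \<Phi> \<mu> (of_real t)) (at (of_real t))"
          by (intro DERIV_diff DERIV_mult' ex_deriv dp H tV)
        moreover have "(ex (of_real t) * deriv p (of_real t)
             + ex (of_real t) * (of_real l * zpos' a b (of_real t) + of_real \<mu> * zneg' a b (of_real t)) * p (of_real t))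
            - exp (of_real l * zpos a b (of_real t)) * \<Phi> \<mu> (of_real t)
          = ex (of_real t) * (of_real l * zpos' a b (of_real t) * p (of_real t) - of_real m * zneg' a b (of_real t) * f (of_real t))"
          unfolding \<Phi>_def ex_split by (simp add: algebra_simps)
        moreover have "\<dots> = of_real l * g t"
        proof -
          have "of_real l * g t = ex (of_real t) * (of_real l * zpos' a b (of_real t) * p (of_real t)
              + (of_real l * of_real \<mu>) * zneg' a b (of_real t) * f (of_real t))"
            unfolding g_def agree[OF tV, symmetric] by (simp add: algebra_simps)
          then show ?thesis unfolding lm by (simp add: algebra_simps)
        qed
        ultimately have "((\<lambda>z. ex z * p z - H z) has_field_derivative of_real l * g t) (at (of_real t))" by simp
        note D = field_vector_diff_chain_at[OF has_vector_derivative_of_real[OF DERIV_ident] this]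
        show "((\<lambda>t. ex (of_real t) * p (of_real t) - H (of_real t)) has_vector_derivative of_real l * g t) (at t within {-r..r})"
          by (rule has_vector_derivative_at_within) (use D in \<open>simp add: o_def\<close>)
      qed
      then have "of_real l * integral {-r..r} g =
          (ex (of_real r) * p (of_real r) - H (of_real r)) - (ex (of_real (- r)) * p (of_real (- r)) - H (of_real (- r)))"
        using has_integral_mult_right[OF integrable_integral[OF gi], of "of_real l" "-r" r] has_integral_unique by blast
      moreover have "integral {-r..r} g = - (integral {-pi..-r} g + integral {r..pi} g)"
        using split by (simp add: eq_neg_iff_add_eq_0 algebra_simps)
      ultimately have "H (of_real r) - H (of_real (- r)) = (ex (of_real r) * p (of_real r) - ex (of_real (- r)) * p (of_real (- r)))
          + of_real l * (integral {-pi..-r} g + integral {r..pi} g)"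
        by (simp add: algebra_simps)
      also have "norm \<dots> \<le> (norm (ex (of_real r) * p (of_real r)) + norm (ex (of_real (- r)) * p (of_real (- r))))
          + l * (norm (integral {-pi..-r} g) + norm (integral {r..pi} g))"
        using l0 by (intro norm_triangle_le add_mono norm_triangle_ineq4)
          (simp add: norm_mult mult_left_mono norm_triangle_ineq)
      also have "\<dots> \<le> (E * exp C * C + E * exp C * C) + l * (M2 * E * pi + M2 * E * pi)"
      proof -
        have e: "norm (ex (of_real x) * p (of_real x)) \<le> E * exp C * C" if "\<bar>x\<bar> = r" for x
        proof -
          have xK: "of_real x \<in> K" using real_K that by simp
          show ?thesis
            unfolding norm_mult using norm_ex[OF Re_real C(4)[OF xK]] that r C(2)[OF xK] E C0
            by (intro mult_mono) auto
        qed
        show ?thesis using l0 r by (intro add_mono mult_left_mono e left right) auto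
      qed
      finally show ?thesis by (simp add: algebra_simps)
    qed

    have "norm (H (Complex \<delta> h) - H (Complex (- \<delta>) h))
        \<le> norm (H (Complex \<delta> h) - H (of_real r)) + norm (H (of_real r) - H (of_real (- r)))
          + norm (H (Complex (- \<delta>) h) - H (of_real (- r)))"
    proof -
      have "H (Complex \<delta> h) - H (Complex (- \<delta>) h) = (H (Complex \<delta> h) - H (of_real r))
          + (H (of_real r) - H (of_real (- r))) - (H (Complex (- \<delta>) h) - H (of_real (- r)))" by simp
      then show ?thesis
        by (metis (no_types, lifting) add_right_mono norm_triangle_ineq norm_triangle_ineq4 order_trans)
    qed
    also have "\<dots> \<le> 2 * M1 * E * h + (2 * exp C * C * E + l * (2 * pi * M2 * E)) + 2 * M1 * E * h"
      using side[of 1] side[of "-1"] bottom by (intro add_mono) auto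
    also have "\<dots> = E * (4 * M1 * h + 2 * exp C * C + l * (2 * pi * M2))"
      by (simp add: algebra_simps)
    also have "\<dots> \<le> E * (A * (1 + l))"
    proof -
      have "0 \<le> l * (4 * M1 * h) + l * (2 * exp C * C) + 2 * pi * M2"
        using l0 M S(4) C0 by simp
      then show ?thesis using E unfolding A_def by (intro mult_left_mono) (auto simp: algebra_simps)
    qed
    finally show ?thesis using top by (simp add: E_def mult.commute)
  qed

  \<comment> \<open>The cosine decreases strictly between \<delta> / 2 and \<delta>, so the lower
    bound has the larger exponential rate.\<close>
  have gap: "c * cos (\<delta> / 2) - c * cos \<delta> > 0"
    using \<delta> \<delta>pi S(3) cos_monotone_0_pi[of "\<delta> / 2" \<delta>] by simp
  show False
  proof (rule exp_not_dominated[OF gap])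
    show "norm g0 / 2 * \<delta> > 0" using g0 \<delta> by simp
    show "norm g0 / 2 * \<delta> * exp (l * (c * cos (\<delta> / 2) - c * cos \<delta>)) \<le> A * (1 + l)"
      if "l \<ge> 1 + m + m / \<epsilon> + 1" for l
      using main[OF that] by (simp add: right_diff_distrib exp_diff field_simps)
  qed
qed

section \<open>The contradiction at the saddle point\<close>

theorem corollary3p7:
  fixes k a b q :: real
    and uin :: "real \<times> real \<Rightarrow> complex"
    and U :: "(complex \<times> complex) set"
    and F :: "complex \<times> complex \<Rightarrow> complex"
  assumes "k > 0" and "a > b" and "b > 0"
    and "0 < q" and "q \<noteq> 1"
    and "incident_wave k uin"
    and "cellipse a b ` T0 a b \<subseteq> U"
    and "analytic_extension uin U F"
    and "F (of_real (a\<^sup>2 / sqrt (a\<^sup>2 - b\<^sup>2)), \<i> * of_real (b\<^sup>2 / sqrt (a\<^sup>2 - b\<^sup>2))) \<noteq> 0"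
  shows "scattered k q (ellipse_region a b) uin"
  unfolding scattered_def
proof
  assume ns: "nonscattering k q (ellipse_region a b) uin"
  define h where "h = saddle_height a b"
  define t0 where "t0 = Complex 0 h"
  \<comment> \<open>Chosen so that \<open>\<mu> = - m / l\<close> satisfies
    \<open>4 * l * \<mu> = - (k\<^sup>2 * q)\<close>.\<close>
  define m where "m = k\<^sup>2 * q / 4"
  note h = saddle_height(4)[OF assms(2,3), folded h_def]
  note t0 = saddle_point[OF assms(2,3), folded h_def, folded t0_def]
  have cont: "continuous_on UNIV (cellipse a b)"
    unfolding cellipse_def[abs_def] by (intro continuous_intros)
  have "open U" using assms(8) by (simp add: analytic_extension_def)
  then have N: "open (cellipse a b -` U)"
    using cont by (simp add: continuous_on_open_vimage)
  have "saddle_cap h \<subseteq> cellipse a b -` U"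
    using saddle_cap_subset_T0[OF assms(2,3)] assms(7) by (auto simp: h_def)
  then obtain e where e: "e > 0" "(\<Union>x\<in>saddle_cap h. ball x e) \<subseteq> cellipse a b -` U"
    using compact_subset_open_imp_ball_epsilon_subset[OF compact_saddle_cap N] by blast
  \<comment> \<open>As the Minkowski sum of the convex cap and a ball this neighbourhood is convex.
    That serves both the primitive and, through connectedness, the identity theorem.\<close>
  define V where "V = (\<Union>x\<in>saddle_cap h. ball x e)"
  have "ball x e = (\<Union>y\<in>ball 0 e. {x + y})" for x :: complex
  proof -
    have "ball x e = (+) x ` ball 0 e" using ball_translation[of x 0 e] by (simp only: add_0_right)
    also have "\<dots> = (\<Union>y\<in>ball 0 e. {x + y})" by blast
    finally show ?thesis .
  qed
  then have "V = (\<Union>x\<in>saddle_cap h. \<Union>y\<in>ball 0 e. {x + y})"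
    unfolding V_def by (intro SUP_cong refl)
  then have "convex V" using convex_sums[OF convex_saddle_cap convex_ball] by metis
  moreover have "open V" unfolding V_def by auto
  ultimately have V: "open V" "convex V" "connected V" by (auto intro: convex_connected)
  have capV: "saddle_cap h \<subseteq> V" using e(1) by (auto simp: V_def)
  have VU: "cellipse a b ` V \<subseteq> U" using e(2) by (auto simp: V_def)
  have r: "arctan (sinh h) > 0" using h by (simp add: zero_less_arctan_iff)
  have rV: "of_real ` {- arctan (sinh h)..arctan (sinh h)} \<subseteq> V"
    using capV h by (auto simp: saddle_cap_def abs_le_iff)
  have t0V: "t0 \<in> V" using capV h by (auto simp: saddle_cap_def t0_def)
  note X = extension_along_ellipse[OF assms(6,8) V(1,3) VU r rV]
  note I = incident_wave_derivatives[OF assms(6)]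
  have ell: "continuous_on UNIV (ellipse a b)"
    unfolding ellipse_def[abs_def] by (intro continuous_intros)
  have "deriv (\<lambda>t. cdz F (cellipse a b t)) (Complex 0 h)
      + of_real m * F (cellipse a b (Complex 0 h)) * zneg' a b (Complex 0 h) = 0"
    unfolding h_def
  proof (rule saddle_amplitude_eq_0[OF assms(2,3) V(1,2) capV[unfolded h_def]])
    show "m > 0" using assms by (simp add: m_def)
    show "continuous_on UNIV (\<lambda>t. uin (ellipse a b t))"
      by (rule continuous_on_compose2[OF I(5) ell]) simp
    show "continuous_on UNIV (\<lambda>t. dz uin (ellipse a b t))"
      unfolding dz_def
      by (intro continuous_intros continuous_on_compose2[OF I(4) ell]) (auto simp: Basis_real_pair)
    show "((\<lambda>t. exp (of_real l * zpos a b (of_real t) + of_real (- m / l) * zneg a b (of_real t))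
        * (of_real (- m / l) * zneg' a b (of_real t) * uin (ellipse a b t)
          + zpos' a b (of_real t) * dz uin (ellipse a b t))) has_integral 0) {-pi..pi}" if "l > 0" for l
      using assms that by (intro boundary_identity[OF _ _ _ _ assms(6) ns]) (auto simp: m_def)
  qed (use X in auto)
  \<comment> \<open>The continued Helmholtz equation contributes - k^2 / 4 to the coefficient of F
    W', and \<open>m\<close> contributes q k^2 / 4.\<close>
  then have "of_real (q - 1) * of_real (k\<^sup>2 / 4) * F (cellipse a b t0) * zneg' a b t0 = 0"
    unfolding t0_def[symmetric] X(5)[OF t0V t0(1)] by (simp add: m_def field_simps)
  then show False
    using assms t0(2,3) by (simp del: of_real_divide)
qed

end
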